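(* For every computably approximable real number $\rho \in [1,2]$ there exists a reordered computable number $x$ satisfying all of the following properties: (1) $\varsigma_x = \rho$; (2) $x$ has a computable name $f \colon \mathbb{N} \to \mathbb{N}$ with $\limsup_{n\to\infty} \sqrt[n]{u_f(n)} = \varsigma_x$; (3) $x$ is not regular.
   Context: $\mathbb{N}=\{0,1,2,\dots\}$. A real number is computably approximable if some computable sequence of rational numbers converges to it; it is left-computable if some computable strictly increasing sequence of rational numbers converges to it. All numbers considered are positive reals. A function $f\colon\mathbb{N}\to\mathbb{N}$ tends to infinity if for every $c$ there is $m$ with $f(n)>c$ for all $n\ge m$. For such $f$, $u_f(n) := |\{k\in\mathbb{N} \mid f(k)=n\}|$. A function $f\colon\mathbb{N}\to\mathbb{N}$ is a name for a real number $x$ if $\sum_{k=0}^\infty 2^{-f(k)} = x$ (then $f$ tends to infinity). A positive real is left-computable iff it has a computable name. A convergent sequence $(x_n)_n$ with limit $x$ converges computably if there is a computable $s\colon\mathbb{N}\to\mathbb{N}$ with $|x-x_k|\le 2^{-n}$ for all $n$ and all $k\ge s(n)$; a series converges computably if the sequence of its partial sums $\left(\sum_{k=0}^{n-1}a_k\right)_n$ does (no computability of the terms is required). A real number is reordered computable if it has a computable name $f$ such that $\sum_{k=0}^\infty u_f(k)\cdot 2^{-k}$ converges computably. For a left-computable number $x$, its characteristic dyadic value is $\varsigma_x := \inf\{\limsup_{n\to\infty}\sqrt[n]{u_f(n)} \mid f \text{ is a computable name for } x\}$. A real number in $[0,1]$ is strongly left-computable if it equals $\sum_{n\in A}2^{-(n+1)}$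 for some computably enumerable set $A\subseteq\mathbb{N}$. A real number is regular if it is a sum of finitely many strongly left-computable numbers. *)

theory Defs
  imports "HOL-Analysis.Analysis"
begin

text \<open>Kleene's \<open>\<mu>\<close>-recursive functions.  Terms carry no arity: a term denotes one partial
  function for each length of the argument list, undefined where the list is too short.  The
  primitive recursion variable and the variable searched over by minimisation come first.\<close>

datatype recf =
    Zero
  | Succ
  | Proj nat
  | Comp recf "recf list"
  | Prec recf recf
  | Mu recf

inductive evals :: "recf \<Rightarrow> nat list \<Rightarrow> nat \<Rightarrow> bool" where
  evals_Zero: "evals Zero xs 0"
| evals_Succ: "evals Succ (x # xs) (Suc x)"
| evals_Proj: "i < length xs \<Longrightarrow> evals (Proj i) xs (xs ! i)"
| evals_Comp: "list_all2 (\<lambda>g y. evals g xs y) gs ys \<Longrightarrow> evals f ys z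
    \<Longrightarrow> evals (Comp f gs) xs z"
| evals_Prec_0: "evals f xs y \<Longrightarrow> evals (Prec f g) (0 # xs) y"
| evals_Prec_Suc: "evals (Prec f g) (n # xs) y \<Longrightarrow> evals g (n # y # xs) z
    \<Longrightarrow> evals (Prec f g) (Suc n # xs) z"
| evals_Mu: "evals f (n # xs) 0 \<Longrightarrow> (\<And>m. m < n \<Longrightarrow> \<exists>y>0. evals f (m # xs) y)
    \<Longrightarrow> evals (Mu f) xs n"

inductive_cases evals_ZeroE: "evals Zero xs y"
inductive_cases evals_SuccE: "evals Succ xs y"
inductive_cases evals_ProjE: "evals (Proj i) xs y"
inductive_cases evals_CompE: "evals (Comp f gs) xs y"
inductive_cases evals_Prec_0E: "evals (Prec f g) (0 # xs) y"
inductive_cases evals_Prec_SucE: "evals (Prec f g) (Suc n # xs) y"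
inductive_cases evals_MuE: "evals (Mu f) xs y"

lemma evals_deterministic: "evals r xs y \<Longrightarrow> evals r xs z \<Longrightarrow> y = z"
proof (induction arbitrary: z rule: evals.induct)
  case (evals_Zero xs)
  then show ?case by (rule evals_ZeroE) simp
next
  case (evals_Succ x xs)
  then show ?case by (rule evals_SuccE) simp
next
  case (evals_Proj i xs)
  from evals_Proj.prems show ?case by (rule evals_ProjE) simp
next
  case (evals_Comp xs gs ys f w)
  from evals_Comp.prems obtain ys' where
    ys': "list_all2 (\<lambda>g y. evals g xs y) gs ys'" "evals f ys' z"
    by (rule evals_CompE)
  have "ys = ys'"
    using evals_Comp.IH(1) ys'(1) by (auto simp: list_all2_conv_all_nth intro!: nth_equalityI)
  then show ?case using evals_Comp.IH(2) ys'(2) by simp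
next
  case (evals_Prec_0 f xs y g)
  from evals_Prec_0.prems have "evals f xs z" by (rule evals_Prec_0E)
  then show ?case by (rule evals_Prec_0.IH)
next
  case (evals_Prec_Suc f g n xs y w)
  from evals_Prec_Suc.prems obtain y' where
    "evals (Prec f g) (n # xs) y'" "evals g (n # y' # xs) z"
    by (rule evals_Prec_SucE)
  then show ?case using evals_Prec_Suc.IH by metis
next
  case (evals_Mu f n xs)
  from evals_Mu.prems have z: "evals f (z # xs) 0" "\<And>m. m < z \<Longrightarrow> \<exists>y>0. evals f (m # xs) y"
    by (rule evals_MuE, blast)+
  show ?case
  proof (cases n z rule: linorder_cases)
    case less
    then obtain y where "y > 0" "evals f (n # xs) y" using z(2) by blast
    then show ?thesis using evals_Mu.IH(1) by fastforce
  next
    case greater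
    then obtain y where "y > 0" "\<And>w. evals f (z # xs) w \<Longrightarrow> y = w" using evals_Mu.IH(2) by blast
    then show ?thesis using z(1) by fastforce
  qed simp
qed

definition computable :: "(nat \<Rightarrow> nat) \<Rightarrow> bool" where
  "computable f \<longleftrightarrow> (\<exists>r. \<forall>n. evals r [n] (f n))"

definition comp_enumerable :: "nat set \<Rightarrow> bool" where
  "comp_enumerable A \<longleftrightarrow> (\<exists>r. A = {n. \<exists>y. evals r [n] y})"

definition computable_rat_seq :: "(nat \<Rightarrow> rat) \<Rightarrow> bool" where
  "computable_rat_seq q \<longleftrightarrow>
    (\<exists>s a b. computable s \<and> computable a \<and> computable b \<and>
      (\<forall>n. q n = (- 1) ^ s n * of_nat (a n) / of_nat (Suc (b n))))"

definition comp_approximable :: "real \<Rightarrow> bool" where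
  "comp_approximable x \<longleftrightarrow>
    (\<exists>q. computable_rat_seq q \<and> (\<lambda>n. real_of_rat (q n)) \<longlonglongrightarrow> x)"

definition converges_computably :: "(nat \<Rightarrow> real) \<Rightarrow> bool" where
  "converges_computably X \<longleftrightarrow>
    (\<exists>x s. X \<longlonglongrightarrow> x \<and> computable s \<and> (\<forall>n. \<forall>k\<ge>s n. \<bar>x - X k\<bar> \<le> (1 / 2) ^ n))"

definition series_converges_computably :: "(nat \<Rightarrow> real) \<Rightarrow> bool" where
  "series_converges_computably a \<longleftrightarrow> converges_computably (\<lambda>n. \<Sum>k<n. a k)"

definition is_name :: "(nat \<Rightarrow> nat) \<Rightarrow> real \<Rightarrow> bool" where
  "is_name f x \<longleftrightarrow> (\<lambda>k. (1 / 2) ^ f k) sums x"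

text \<open>The preimages counted here are finite whenever \<open>f\<close> tends to infinity, in particular
  whenever \<open>f\<close> is a name.\<close>

definition preimage_count :: "(nat \<Rightarrow> nat) \<Rightarrow> nat \<Rightarrow> nat" where
  "preimage_count f n = card {k. f k = n}"

definition reordered_computable :: "real \<Rightarrow> bool" where
  "reordered_computable x \<longleftrightarrow>
    (\<exists>f. computable f \<and> is_name f x \<and>
      series_converges_computably (\<lambda>k. real (preimage_count f k) * (1 / 2) ^ k))"

text \<open>Growth rates are taken in the extended reals so that \<open>limsup\<close> and \<open>Inf\<close> are total; the
  value of \<^term>\<open>root 0\<close> does not affect the \<open>limsup\<close>.\<close>

definition growth :: "(nat \<Rightarrow> nat) \<Rightarrow> ereal" where
  "growth f = limsup (\<lambda>n. ereal (root n (real (preimage_count f n))))"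

definition char_dyadic_value :: "real \<Rightarrow> ereal" where
  "char_dyadic_value x = Inf {growth f | f. computable f \<and> is_name f x}"

definition strongly_left_computable :: "real \<Rightarrow> bool" where
  "strongly_left_computable x \<longleftrightarrow> x \<in> {0..1} \<and>
    (\<exists>A. comp_enumerable A \<and> ((\<lambda>n. (1 / 2) ^ (n + 1)) has_sum x) A)"

definition regular :: "real \<Rightarrow> bool" where
  "regular x \<longleftrightarrow> (\<exists>ys. (\<forall>y\<in>set ys. strongly_left_computable y) \<and> x = sum_list ys)"

end

theory Submission
  imports Defs "HOL-Library.Nat_Bijection" "HOL-Real_Asymp.Real_Asymp"
begin

text \<open>Let \<open>\<rho>\<^sub>n\<close> be the given approximations and put \<open>w n\<close> close to \<open>n\<^sup>2 \<rho>\<^sub>n\<^sup>n\<close>.  The number \<open>x\<close> gets an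
  item \<open>2\<^sup>-\<^sup>n\<close> for each pair of a program \<open>a < n\<close> and an advice \<open>b < w n\<close> such that \<open>a\<close> halts on
  \<open>(n, b)\<close>, enumerated no earlier than the halting computation; every other index \<open>k\<close> contributes
  a harmless \<open>2\<^sup>-\<^sup>k\<close>.

  Given any computable name of \<open>x\<close>, count its items of level at most about \<open>n\<close>, and those of
  higher level by their weight relative to \<open>2\<^sup>-\<^sup>n\<close>.  The integer part \<open>N\<close> of this count is enough
  advice to compute from the name an approximation of \<open>x\<close> from below within \<open>2\<^sup>-\<^sup>n\<close>, hence a
  stage after which no item of level \<open>n\<close> of \<open>x\<close> appears.  If \<open>N < w n\<close>, this computation would
  bound its own halting time.  So \<open>N \<ge> w n\<close> for almost all \<open>n\<close>, whereas a name of growth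
  below \<open>\<rho>\<close> has \<open>N = O(n \<sigma>\<^sup>n)\<close> for some \<open>\<sigma>\<close> that is \<open>1\<close> or less than \<open>\<rho>\<close>, and a sum of finitely
  many strongly left-computable numbers has \<open>N = O(n)\<close>.\<close>

section \<open>Closure properties of computable functions\<close>

lemma evals_ProjI: "i < length xs \<Longrightarrow> xs ! i = y \<Longrightarrow> evals (Proj i) xs y"
  using evals_Proj by blast

lemma evals_Comp1: "evals g xs y \<Longrightarrow> evals f [y] z \<Longrightarrow> evals (Comp f [g]) xs z"
  by (rule evals_Comp[where ys = "[y]"]) auto

lemma evals_Comp2:
  "evals g xs y \<Longrightarrow> evals h xs y' \<Longrightarrow> evals f [y, y'] z \<Longrightarrow> evals (Comp f [g, h]) xs z"
  by (rule evals_Comp[where ys = "[y, y']"]) auto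

definition computable2 :: "(nat \<Rightarrow> nat \<Rightarrow> nat) \<Rightarrow> bool" where
  "computable2 F \<longleftrightarrow> (\<exists>r. \<forall>x y. evals r [x, y] (F x y))"

definition computable3 :: "(nat \<Rightarrow> nat \<Rightarrow> nat \<Rightarrow> nat) \<Rightarrow> bool" where
  "computable3 F \<longleftrightarrow> (\<exists>r. \<forall>x y z. evals r [x, y, z] (F x y z))"

lemma computable_id: "computable (\<lambda>x. x)"
  unfolding computable_def by (rule exI[of _ "Proj 0"]) (auto intro: evals_ProjI)

lemma computable_compose: "computable f \<Longrightarrow> computable g \<Longrightarrow> computable (\<lambda>x. f (g x))"
  unfolding computable_def by (meson evals_Comp1)

lemma computable_compose2:
  "computable2 F \<Longrightarrow> computable f \<Longrightarrow> computable g \<Longrightarrow> computable (\<lambda>x. F (f x) (g x))"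
  unfolding computable_def computable2_def by (meson evals_Comp2)

lemma computable_Succ: "computable Suc"
  unfolding computable_def by (rule exI[of _ Succ]) (auto intro: evals_Succ)

lemmas computable_Suc = computable_compose[OF computable_Succ]

lemma computable_const: "computable (\<lambda>_. c)"
proof (induction c)
  case 0
  show ?case unfolding computable_def by (auto intro: evals_Zero)
next
  case (Suc c)
  then show ?case by (rule computable_Suc)
qed

lemma computable2_proj: "computable2 (\<lambda>x y. x)" "computable2 (\<lambda>x y. y)"
  unfolding computable2_def
  by (rule exI[of _ "Proj 0"], auto intro: evals_ProjI)
     (rule exI[of _ "Proj 1"], auto intro: evals_ProjI)

lemma computable2_compose:
  "computable f \<Longrightarrow> computable2 G \<Longrightarrow> computable2 (\<lambda>x y. f (G x y))"
  unfolding computable_def computable2_def by (meson evals_Comp1)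

lemma computable2_compose2:
  "computable2 F \<Longrightarrow> computable2 G \<Longrightarrow> computable2 H \<Longrightarrow> computable2 (\<lambda>x y. F (G x y) (H x y))"
  unfolding computable2_def by (meson evals_Comp2)

lemma computable3_proj:
  "computable3 (\<lambda>x y z. x)" "computable3 (\<lambda>x y z. y)" "computable3 (\<lambda>x y z. z)"
  unfolding computable3_def
  by (rule exI[of _ "Proj 0"], auto intro: evals_ProjI)
     (rule exI[of _ "Proj 1"], auto intro: evals_ProjI,
      rule exI[of _ "Proj 2"], auto intro: evals_ProjI)

lemma computable3_compose:
  "computable f \<Longrightarrow> computable3 G \<Longrightarrow> computable3 (\<lambda>x y z. f (G x y z))"
  unfolding computable_def computable3_def by (meson evals_Comp1)

lemma computable3_compose2:
  "computable2 F \<Longrightarrow> computable3 G \<Longrightarrow> computable3 H \<Longrightarrow>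
    computable3 (\<lambda>x y z. F (G x y z) (H x y z))"
  unfolding computable2_def computable3_def by (meson evals_Comp2)

lemma computable2_rec_nat:
  assumes "computable f" "computable3 g"
  shows "computable2 (\<lambda>n x. rec_nat (f x) (\<lambda>n y. g n y x) n)"
proof -
  obtain rf rg where r: "\<And>x. evals rf [x] (f x)" "\<And>x y z. evals rg [x, y, z] (g x y z)"
    using assms unfolding computable_def computable3_def by blast
  have "evals (Prec rf rg) [n, x] (rec_nat (f x) (\<lambda>n y. g n y x) n)" for n x
    by (induction n) (auto intro: evals_Prec_0 evals_Prec_Suc r)
  then show ?thesis unfolding computable2_def by blast
qed

lemma computable2_add: "computable2 (+)"
proof -
  have "rec_nat x (\<lambda>n y. Suc y) n = n + x" for n x by (induction n) auto
  then show ?thesis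
    using computable2_rec_nat[OF computable_id
      computable3_compose[OF computable_Succ computable3_proj(2)]]
    by simp
qed

lemma computable2_mult: "computable2 (*)"
proof -
  have "rec_nat 0 (\<lambda>n y. y + x) n = n * x" for n x by (induction n) auto
  then show ?thesis
    using computable2_rec_nat[OF computable_const[of 0]
      computable3_compose2[OF computable2_add computable3_proj(2,3)]]
    by simp
qed

lemma computable_pred: "computable (\<lambda>n. n - 1)"
proof -
  have "rec_nat 0 (\<lambda>n y. n) n = n - 1" for n :: nat by (cases n) auto
  then show ?thesis
    using computable_compose2[OF computable2_rec_nat[OF computable_const[of 0] computable3_proj(1)]
        computable_id computable_id]
    by simp
qed

lemma computable2_diff: "computable2 (-)"
proof -
  have "rec_nat x (\<lambda>n y. y - 1) n = x - n" for n x :: nat by (induction n) auto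
  then have "computable2 (\<lambda>n x. x - n)"
    using computable2_rec_nat[OF computable_id
      computable3_compose[OF computable_pred computable3_proj(2)]]
    by simp
  from computable2_compose2[OF this computable2_proj(2,1)] show ?thesis by simp
qed

lemmas computable_add = computable_compose2[OF computable2_add]
  and computable_mult = computable_compose2[OF computable2_mult]
  and computable_diff = computable_compose2[OF computable2_diff]

lemma computable_triangle: "computable triangle"
proof -
  have "rec_nat 0 (\<lambda>n y. y + Suc n) n = triangle n" for n by (induction n) auto
  then show ?thesis
    using computable_compose2[OF computable2_rec_nat[OF computable_const[of 0]
        computable3_compose2[OF computable2_add computable3_proj(2)
          computable3_compose[OF computable_Succ computable3_proj(1)]]]
        computable_id computable_id]
    by simp
qed

section \<open>Computability of pairing and of the projections\<close>

definition pr :: "nat \<Rightarrow> nat \<Rightarrow> nat" where "pr a b = prod_encode (a, b)"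
definition p1 :: "nat \<Rightarrow> nat" where "p1 n = fst (prod_decode n)"
definition p2 :: "nat \<Rightarrow> nat" where "p2 n = snd (prod_decode n)"

lemma p1_pr [simp]: "p1 (pr a b) = a" and p2_pr [simp]: "p2 (pr a b) = b"
  by (auto simp: pr_def p1_def p2_def)

lemma pr_p1_p2 [simp]: "pr (p1 n) (p2 n) = n"
  by (auto simp: pr_def p1_def p2_def)

lemma pr_inject [simp]: "pr a b = pr c d \<longleftrightarrow> a = c \<and> b = d"
  by (auto simp: pr_def)

lemma pr_eq_0_iff [simp]: "pr a b = 0 \<longleftrightarrow> a = 0 \<and> b = 0"
proof -
  have "pr 0 0 = 0" by (simp add: pr_def prod_encode_def)
  then show ?thesis by (metis pr_inject)
qed

lemma p1_0 [simp]: "p1 0 = 0" and p2_0 [simp]: "p2 0 = 0"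
  using p1_pr[of 0 0] p2_pr[of 0 0] by (simp_all del: p1_pr p2_pr add: pr_def prod_encode_def)

lemma le_pr2: "b \<le> pr a b"
  by (auto simp: pr_def le_prod_encode_2)

text \<open>The inverse of \<open>triangle\<close>, rounded down, as a primitive recursion. Since
  subtraction truncates, the added term is 1 exactly when \<open>Suc n\<close> has reached the next
  triangular number.\<close>

definition triangle_root :: "nat \<Rightarrow> nat" where
  "triangle_root = rec_nat 0 (\<lambda>n y. y + (1 - (triangle (Suc y) - Suc n)))"

lemma triangle_root_bounds: "triangle (triangle_root n) \<le> n \<and> n < triangle (Suc (triangle_root n))"
proof (induction n)
  case (Suc n)
  show ?case
  proof (cases "triangle (Suc (triangle_root n)) \<le> Suc n")
    case True
    then have "triangle_root (Suc n) = Suc (triangle_root n)" by (simp add: triangle_root_def)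
    with True Suc show ?thesis by simp
  next
    case False
    then have "triangle_root (Suc n) = triangle_root n" by (simp add: triangle_root_def)
    with False Suc show ?thesis by simp
  qed
qed (simp add: triangle_root_def)

lemma triangle_mono: "m \<le> n \<Longrightarrow> triangle m \<le> triangle n"
  by (rule lift_Suc_mono_le[of triangle]) auto

lemma triangle_root_pr: "triangle_root (pr a b) = a + b"
proof -
  have "triangle (a + b) \<le> pr a b" "pr a b < triangle (Suc (a + b))"
    by (auto simp: pr_def prod_encode_def)
  then show ?thesis
    using triangle_root_bounds[of "pr a b"] triangle_mono[of "Suc (triangle_root (pr a b))" "a + b"]
      triangle_mono[of "Suc (a + b)" "triangle_root (pr a b)"]
    by (cases "triangle_root (pr a b)" "a + b" rule: linorder_cases) auto
qed

lemma p1_eq: "p1 n = n - triangle (triangle_root n)"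
proof -
  have "p1 n = pr (p1 n) (p2 n) - triangle (triangle_root (pr (p1 n) (p2 n)))"
    unfolding triangle_root_pr by (simp add: pr_def prod_encode_def)
  then show ?thesis by simp
qed

lemma p2_eq: "p2 n = triangle_root n - p1 n"
  using triangle_root_pr[of "p1 n" "p2 n"] by simp

lemma computable_triangle_root: "computable triangle_root"
  using computable_compose2[OF computable2_rec_nat[OF computable_const[of 0]
      computable3_compose2[OF computable2_add computable3_proj(2)
        computable3_compose2[OF computable2_diff
          computable3_compose[OF computable_const[of 1] computable3_proj(1)]
          computable3_compose2[OF computable2_diff
           computable3_compose[OF computable_triangle
             computable3_compose[OF computable_Succ computable3_proj(2)]]
           computable3_compose[OF computable_Succ computable3_proj(1)]]]]]
      computable_id computable_id]
  by (simp add: triangle_root_def)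

lemma computable_p1': "computable p1"
  unfolding p1_eq[abs_def]
  by (intro computable_diff computable_id computable_compose[OF computable_triangle]
      computable_compose[OF computable_triangle_root])

lemma computable_p2': "computable p2"
  unfolding p2_eq[abs_def]
  by (intro computable_diff computable_id computable_compose[OF computable_p1']
      computable_compose[OF computable_triangle_root])

lemma computable2_pr: "computable2 pr"
proof -
  have "computable2 (\<lambda>a b. triangle (a + b) + a)"
    by (intro computable2_compose2[OF computable2_add] computable2_compose[OF computable_triangle]
        computable2_proj)
  then show ?thesis by (simp add: pr_def[abs_def] prod_encode_def)
qed

lemmas computable_pr = computable_compose2[OF computable2_pr]
  and computable_p1 = computable_compose[OF computable_p1']
  and computable_p2 = computable_compose[OF computable_p2']

text \<open>The arguments of \<open>G\<close> are packed into one number, so that the premise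
  concerns a unary function again and the rules of \<open>computable_intros\<close> can be chained
  on nested expressions.\<close>

lemma computable_rec_nat:
  assumes h: "computable h" and f: "computable f"
    and g: "computable (\<lambda>z. G (p1 z) (p1 (p2 z)) (p2 (p2 z)))"
  shows "computable (\<lambda>x. rec_nat (f x) (\<lambda>n y. G n y x) (h x))"
proof -
  have "computable3 G"
    using computable3_compose[OF g computable3_compose2[OF computable2_pr computable3_proj(1)
      computable3_compose2[OF computable2_pr computable3_proj(2,3)]]] by simp
  from computable_compose2[OF computable2_rec_nat[OF f this] h computable_id] show ?thesis by simp
qed

section \<open>Decidable predicates, bounded sums and search\<close>

definition decidable :: "(nat \<Rightarrow> bool) \<Rightarrow> bool" where
  "decidable P \<longleftrightarrow> computable (\<lambda>x. of_bool (P x))"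

lemma computable_if:
  assumes "decidable P" "computable f" "computable g"
  shows "computable (\<lambda>x. if P x then f x else g x)"
proof -
  have "(\<lambda>x. if P x then f x else g x) = (\<lambda>x. of_bool (P x) * f x + (1 - of_bool (P x)) * g x)"
    by auto
  then show ?thesis
    using assms unfolding decidable_def
    by (simp only:) (intro computable_add computable_mult computable_diff computable_const)
qed

lemma decidable_le:
  assumes "computable f" "computable g" shows "decidable (\<lambda>x. f x \<le> g x)"
proof -
  have "(\<lambda>x. of_bool (f x \<le> g x)) = (\<lambda>x. 1 - (f x - g x))" by auto
  with assms show ?thesis
    unfolding decidable_def by (simp only:) (intro computable_diff computable_const)
qed

lemma decidable_conj:
  assumes "decidable P" "decidable Q" shows "decidable (\<lambda>x. P x \<and> Q x)"
  using computable_mult[OF assms[unfolded decidable_def]] by (simp add: decidable_def of_bool_conj)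

lemma decidable_less: "computable f \<Longrightarrow> computable g \<Longrightarrow> decidable (\<lambda>x. f x < g x)"
  unfolding Suc_le_eq[symmetric] by (intro decidable_le computable_Suc)

lemma decidable_eq: "computable f \<Longrightarrow> computable g \<Longrightarrow> decidable (\<lambda>x. f x = g x)"
  unfolding order_eq_iff by (intro decidable_conj decidable_le)

lemma computable_sum:
  assumes "computable h" "computable (\<lambda>z. F (p1 z) (p2 z))"
  shows "computable (\<lambda>x. \<Sum>k<h x. F k x)"
proof -
  have "(\<Sum>k<n. F k x) = rec_nat 0 (\<lambda>k y. y + F k x) n" for n x by (induction n) auto
  moreover have "computable (\<lambda>z. F (p1 z) (p2 (p2 z)))"
    using computable_compose[OF assms(2), of "\<lambda>z. pr (p1 z) (p2 (p2 z))"]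
    by (simp add: computable_pr computable_p1 computable_p2 computable_id)
  ultimately show ?thesis
    using assms(1)
    by (simp only:) (intro computable_rec_nat computable_const computable_add computable_p1
        computable_p2 computable_id)
qed

lemma computable_power:
  assumes "computable f" "computable g" shows "computable (\<lambda>x. f x ^ g x)"
proof -
  have "a ^ n = rec_nat 1 (\<lambda>k y. y * a) n" for n a :: nat by (induction n) auto
  then show ?thesis
    using assms
    by (simp only:) (intro computable_rec_nat computable_const computable_mult computable_p1
        computable_p2 computable_id computable_compose[OF assms(1)])
qed

lemmas computable_intros = computable_const computable_id computable_Suc computable_add
  computable_mult computable_diff computable_pr computable_p1 computable_p2 computable_if
  computable_power computable_sum computable_rec_nat decidable_conj decidable_le decidable_less
  decidable_eq

text \<open>A search need not succeed on every input, so its specification is stated for a program.\<close>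

lemma search_program:
  assumes "decidable P"
  shows "\<exists>r. \<forall>b z. P (pr z b) \<longrightarrow> (\<exists>y. evals r [b] y \<and> P (pr y b))"
proof -
  \<comment> \<open>\<open>Mu\<close> looks for a zero, so truth is coded by 0 here.\<close>
  have "computable (\<lambda>x. 1 - of_bool (P x))"
    using assms unfolding decidable_def by (intro computable_intros)
  from computable2_compose[OF this computable2_pr]
  obtain r where r: "\<And>z b. evals r [z, b] (1 - of_bool (P (pr z b)))"
    unfolding computable2_def by blast
  have "\<exists>y. evals (Mu r) [b] y \<and> P (pr y b)" if "P (pr z b)" for b z
  proof -
    define y where "y = (LEAST y. P (pr y b))"
    have P: "P (pr y b)" unfolding y_def using that by (rule LeastI)
    have "evals (Mu r) [b] y"
    proof (rule evals_Mu)
      show "evals r [y, b] 0" using r[of y b] P by simp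
      show "\<exists>v>0. evals r [m, b] v" if "m < y" for m
        using r[of m b] not_less_Least[OF that[unfolded y_def]] by (intro exI[of _ 1]) simp
    qed
    with P show ?thesis by blast
  qed
  then show ?thesis by blast
qed

section \<open>A universal machine\<close>

definition consn :: "nat \<Rightarrow> nat \<Rightarrow> nat" where "consn x xs = Suc (pr x xs)"
definition hdn :: "nat \<Rightarrow> nat" where "hdn xs = p1 (xs - 1)"
definition tln :: "nat \<Rightarrow> nat" where "tln xs = p2 (xs - 1)"

lemma consn_simps [simp]: "hdn (consn x xs) = x" "tln (consn x xs) = xs" "consn x xs \<noteq> 0" "tln 0 = 0"
  by (auto simp: consn_def hdn_def tln_def)

lemma list_encode_Cons [simp]: "list_encode (x # xs) = consn x (list_encode xs)"
  by (simp add: consn_def pr_def)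

declare list_encode.simps(2) [simp del]

text \<open>The inner functions of a composition are listed in reverse: the machine below conses their
  values onto an accumulator, which then ends up in the right order.\<close>

fun code :: "recf \<Rightarrow> nat" where
  "code Zero = pr 0 0"
| "code Succ = pr 1 0"
| "code (Proj i) = pr 2 i"
| "code (Comp f gs) = pr 3 (pr (code f) (list_encode (rev (map code gs))))"
| "code (Prec f g) = pr 4 (pr (code f) (code g))"
| "code (Mu f) = pr 5 (code f)"

declare code.simps [simp del]

text \<open>States of an abstract machine: evaluate a program on arguments, return a value, or collect
  the values of the inner functions of a composition in \<open>acc\<close>.  The last
  component \<open>K\<close> is the stack of pending frames, \<open>0\<close> being the empty stack.\<close>

definition ev :: "nat \<Rightarrow> nat \<Rightarrow> nat \<Rightarrow> nat" where
  "ev c xs K = pr 1 (pr c (pr xs K))"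

definition ret :: "nat \<Rightarrow> nat \<Rightarrow> nat" where
  "ret y K = pr 2 (pr y K)"

definition args :: "nat \<Rightarrow> nat \<Rightarrow> nat \<Rightarrow> nat \<Rightarrow> nat \<Rightarrow> nat" where
  "args f gs xs acc K = pr 3 (pr f (pr gs (pr xs (pr acc K))))"

definition comp_frame :: "nat \<Rightarrow> nat \<Rightarrow> nat \<Rightarrow> nat \<Rightarrow> nat \<Rightarrow> nat" where
  "comp_frame f gs xs acc K = pr 1 (pr f (pr gs (pr xs (pr acc K))))"

definition prec_frame :: "nat \<Rightarrow> nat \<Rightarrow> nat \<Rightarrow> nat \<Rightarrow> nat" where
  "prec_frame g n xs K = pr 2 (pr g (pr n (pr xs K)))"

definition mu_frame :: "nat \<Rightarrow> nat \<Rightarrow> nat \<Rightarrow> nat \<Rightarrow> nat" where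
  "mu_frame f xs n K = pr 3 (pr f (pr xs (pr n K)))"

text \<open>Where the argument list is too short the machine moves to the state 0, which
  \<open>step\<close> fixes and which differs from \<open>fin\<close>; such a run never halts.
  Iterating \<open>tln\<close> drops the arguments in front of the projected one.\<close>

definition step_ev :: "nat \<Rightarrow> nat \<Rightarrow> nat \<Rightarrow> nat" where
  "step_ev c xs K =
    (if p1 c = 0 then ret 0 K
     else if p1 c = 1 then (if xs = 0 then 0 else ret (Suc (hdn xs)) K)
     else if p1 c = 2 then
       (if rec_nat xs (\<lambda>_. tln) (p2 c) = 0 then 0 else ret (hdn (rec_nat xs (\<lambda>_. tln) (p2 c))) K)
     else if p1 c = 3 then args (p1 (p2 c)) (p2 (p2 c)) xs 0 K
     else if p1 c = 4 then
       (if xs = 0 then 0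
        else if hdn xs = 0 then ev (p1 (p2 c)) (tln xs) K
        else ev c (consn (hdn xs - 1) (tln xs)) (prec_frame (p2 (p2 c)) (hdn xs - 1) (tln xs) K))
     else ev (p2 c) (consn 0 xs) (mu_frame (p2 c) xs 0 K))"

definition step_args :: "nat \<Rightarrow> nat \<Rightarrow> nat \<Rightarrow> nat \<Rightarrow> nat \<Rightarrow> nat" where
  "step_args f gs xs acc K =
    (if gs = 0 then ev f acc K else ev (hdn gs) xs (comp_frame f (tln gs) xs acc K))"

text \<open>A value returned to the empty stack is counted down to \<open>0\<close> and the state \<open>ret 0 0\<close> is left
  immediately, so that it is reached at most once and not before as many steps as the value.\<close>

definition step_ret :: "nat \<Rightarrow> nat \<Rightarrow> nat" where
  "step_ret y K =
    (if K = 0 then (if y = 0 then 0 else ret (y - 1) 0)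
     else if p1 K = 1 then
       args (p1 (p2 K)) (p1 (p2 (p2 K))) (p1 (p2 (p2 (p2 K)))) (consn y (p1 (p2 (p2 (p2 (p2 K))))))
         (p2 (p2 (p2 (p2 (p2 K)))))
     else if p1 K = 2 then
       ev (p1 (p2 K)) (consn (p1 (p2 (p2 K))) (consn y (p1 (p2 (p2 (p2 K)))))) (p2 (p2 (p2 (p2 K))))
     else if y = 0 then ret (p1 (p2 (p2 (p2 K)))) (p2 (p2 (p2 (p2 K))))
     else ev (p1 (p2 K)) (consn (Suc (p1 (p2 (p2 (p2 K))))) (p1 (p2 (p2 K))))
         (mu_frame (p1 (p2 K)) (p1 (p2 (p2 K))) (Suc (p1 (p2 (p2 (p2 K))))) (p2 (p2 (p2 (p2 K))))))"

definition step :: "nat \<Rightarrow> nat" where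
  "step z =
    (if p1 z = 1 then step_ev (p1 (p2 z)) (p1 (p2 (p2 z))) (p2 (p2 (p2 z)))
     else if p1 z = 2 then step_ret (p1 (p2 z)) (p2 (p2 z))
     else if p1 z = 3 then
       step_args (p1 (p2 z)) (p1 (p2 (p2 z))) (p1 (p2 (p2 (p2 z)))) (p1 (p2 (p2 (p2 (p2 z)))))
         (p2 (p2 (p2 (p2 (p2 z)))))
     else 0)"

lemma computable_step: "computable step"
  unfolding step_def[abs_def] step_ev_def step_ret_def step_args_def ev_def ret_def args_def
    comp_frame_def prec_frame_def mu_frame_def consn_def hdn_def tln_def
  by (intro computable_intros)

definition run :: "nat \<Rightarrow> nat \<Rightarrow> nat" where
  "run t z = rec_nat z (\<lambda>_. step) t"

lemma run_0 [simp]: "run 0 z = z" and run_Suc: "run (Suc t) z = step (run t z)"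
  by (simp_all add: run_def)

lemma run_Suc': "run (Suc t) z = run t (step z)"
  by (induction t) (simp_all add: run_Suc)

lemma run_add: "run (s + t) z = run s (run t z)"
  by (induction s) (simp_all add: run_Suc)

lemma computable_run: "computable f \<Longrightarrow> computable g \<Longrightarrow> computable (\<lambda>x. run (f x) (g x))"
  unfolding run_def by (intro computable_rec_nat computable_compose[OF computable_step] computable_intros)

definition fin :: nat where "fin = ret 0 0"

lemma fin_neq [simp]: "fin \<noteq> 0" "ev c xs K \<noteq> fin" "args f gs xs acc K \<noteq> fin" "K \<noteq> 0 \<Longrightarrow> ret y K \<noteq> fin"
  by (auto simp: fin_def ev_def ret_def args_def)

lemma frame_neq_0 [simp]:
  "comp_frame f gs xs acc K \<noteq> 0" "prec_frame g n xs K \<noteq> 0" "mu_frame f xs n K \<noteq> 0"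
  by (auto simp: comp_frame_def prec_frame_def mu_frame_def)

lemma step_simps [simp]:
  "step 0 = 0"
  "step (ev c xs K) = step_ev c xs K"
  "step (args f gs xs acc K) = step_args f gs xs acc K"
  "step (ret y K) = step_ret y K"
  by (auto simp: step_def ev_def args_def ret_def)

lemma step_fin [simp]: "step fin = 0"
  by (simp add: fin_def step_ret_def)

lemma step_args_simps [simp]:
  "step_args f 0 xs acc K = ev f acc K"
  "step_args f (consn g gs) xs acc K = ev g xs (comp_frame f gs xs acc K)"
  by (auto simp: step_args_def)

lemma step_ret_simps [simp]:
  "step_ret 0 0 = 0"
  "step_ret (Suc y) 0 = ret y 0"
  "step_ret y (comp_frame f gs xs acc K) = args f gs xs (consn y acc) K"
  "step_ret y (prec_frame g n xs K) = ev g (consn n (consn y xs)) K"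
  "step_ret 0 (mu_frame f xs n K) = ret n K"
  "step_ret (Suc y) (mu_frame f xs n K) = ev f (consn (Suc n) xs) (mu_frame f xs (Suc n) K)"
  by (auto simp: step_ret_def) (auto simp: comp_frame_def prec_frame_def mu_frame_def)

text \<open>Past the end of the list both sides are 0, because \<open>tln 0 = 0\<close>.\<close>

lemma rec_nat_tln:
  "rec_nat (list_encode xs) (\<lambda>_. tln) i = list_encode (drop i xs)"
proof (induction i)
  case (Suc i)
  then show ?case by (cases "drop i xs") (auto simp: drop_Suc tl_drop[symmetric])
qed simp

lemma list_encode_eq_0_iff [simp]: "list_encode xs = 0 \<longleftrightarrow> xs = []"
  by (cases xs) auto

lemma step_ev_simps [simp]:
  "step_ev (code Zero) xs K = ret 0 K"
  "step_ev (code Succ) 0 K = 0"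
  "step_ev (code Succ) (consn x ys) K = ret (Suc x) K"
  "step_ev (code (Proj i)) (list_encode us) K = (if i < length us then ret (us ! i) K else 0)"
  "step_ev (code (Comp f gs)) xs K = args (code f) (list_encode (rev (map code gs))) xs 0 K"
  "step_ev (code (Prec f g)) 0 K = 0"
  "step_ev (code (Prec f g)) (consn 0 ys) K = ev (code f) ys K"
  "step_ev (code (Prec f g)) (consn (Suc n) ys) K =
     ev (code (Prec f g)) (consn n ys) (prec_frame (code g) n ys K)"
  "step_ev (code (Mu f)) xs K = ev (code f) (consn 0 xs) (mu_frame (code f) xs 0 K)"
  by (auto simp: step_ev_def code.simps rec_nat_tln Cons_nth_drop_Suc[symmetric])

section \<open>Completeness of the machine: evaluations lead to halting runs\<close>

definition reach :: "nat \<Rightarrow> nat \<Rightarrow> bool" where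
  "reach z z' \<longleftrightarrow> (\<exists>t. run t z = z')"

lemma reach_refl: "reach z z"
  unfolding reach_def by (rule exI[of _ 0]) simp

lemma reach_trans [trans]: "reach x y \<Longrightarrow> reach y z \<Longrightarrow> reach x z"
  unfolding reach_def by (metis run_add)

lemma reach_step: "reach (step x) y \<Longrightarrow> reach x y"
  unfolding reach_def by (metis run_Suc')

text \<open>The premise quantifies over all stacks because each inner function is run on top of its
  own \<open>comp_frame\<close>.\<close>

lemma reach_args:
  assumes "list_all2 (\<lambda>g y. \<forall>K. reach (ev (code g) xs K) (ret y K)) gs ys"
  shows "reach (args f (list_encode (map code gs)) xs (list_encode acc) K)
    (ev f (list_encode (rev ys @ acc)) K)"
  using assms
proof (induction arbitrary: acc rule: list_all2_induct)
  case Nil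
  show ?case by (rule reach_step) (simp add: reach_refl)
next
  case (Cons g gs y ys)
  have "reach (ev (code g) xs (comp_frame f (list_encode (map code gs)) xs (list_encode acc) K))
      (ret y (comp_frame f (list_encode (map code gs)) xs (list_encode acc) K))"
    using Cons by blast
  also have "reach \<dots> (args f (list_encode (map code gs)) xs (list_encode (y # acc)) K)"
    by (rule reach_step) (simp add: reach_refl)
  also have "reach \<dots> (ev f (list_encode (rev ys @ y # acc)) K)"
    by (rule Cons.IH)
  finally show ?case by - (rule reach_step, simp)
qed

text \<open>Induction on the evaluation with an arbitrary stack: a nested evaluation runs above the
  frame that its context has pushed. In the \<open>Mu\<close> case the candidates below the result
  are passed one after the other.\<close>

lemma reach_ret: "evals r xs y \<Longrightarrow> reach (ev (code r) (list_encode xs) K) (ret y K)"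
proof (induction arbitrary: K rule: evals.induct)
  case (evals_Comp xs gs ys f z)
  have "list_all2 (\<lambda>g y. \<forall>K. reach (ev (code g) (list_encode xs) K) (ret y K)) (rev gs) (rev ys)"
    using evals_Comp.IH(1) by (auto elim: list_all2_mono)
  from reach_args[OF this, of "code f" "[]"]
  have "reach (args (code f) (list_encode (rev (map code gs))) (list_encode xs) 0 K)
      (ev (code f) (list_encode ys) K)"
    by (simp add: rev_map)
  also have "reach \<dots> (ret z K)" by (rule evals_Comp.IH)
  finally show ?case by - (rule reach_step, simp)
next
  case (evals_Prec_Suc f g n xs y z)
  let ?K = "prec_frame (code g) n (list_encode xs) K"
  have "reach (ev (code (Prec f g)) (list_encode (n # xs)) ?K) (ret y ?K)"
    by (rule evals_Prec_Suc.IH)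
  also have "reach \<dots> (ev (code g) (list_encode (n # y # xs)) K)"
    by (rule reach_step) (simp add: reach_refl)
  also have "reach \<dots> (ret z K)" by (rule evals_Prec_Suc.IH)
  finally show ?case by - (rule reach_step, simp)
next
  case (evals_Mu f n xs)
  let ?K = "\<lambda>m. mu_frame (code f) (list_encode xs) m K"
  have "reach (ev (code f) (list_encode (0 # xs)) (?K 0)) (ev (code f) (list_encode (m # xs)) (?K m))"
    if "m \<le> n" for m
    using that
  proof (induction m)
    case (Suc m)
    then obtain y where y: "reach (ev (code f) (list_encode (m # xs)) (?K m)) (ret (Suc y) (?K m))"
      using evals_Mu.IH(2)[of m] by (auto simp: gr0_conv_Suc)
    have "reach (ev (code f) (list_encode (0 # xs)) (?K 0)) (ev (code f) (list_encode (m # xs)) (?K m))"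
      using Suc by simp
    also note y
    also have "reach (ret (Suc y) (?K m)) (ev (code f) (list_encode (Suc m # xs)) (?K (Suc m)))"
      by (rule reach_step) (simp add: reach_refl)
    finally show ?case .
  qed (rule reach_refl)
  from this[of n]
  have "reach (ev (code f) (list_encode (0 # xs)) (?K 0)) (ev (code f) (list_encode (n # xs)) (?K n))"
    by simp
  also have "reach \<dots> (ret 0 (?K n))" by (rule evals_Mu.IH)
  also have "reach \<dots> (ret n K)" by (rule reach_step) (simp add: reach_refl)
  finally show ?case by - (rule reach_step, simp)
next
  case (evals_Prec_0 f xs y g)
  have "reach (ev (code f) (list_encode xs) K) (ret y K)" by (rule evals_Prec_0.IH)
  then show ?case by - (rule reach_step, simp)
qed (rule reach_step, simp add: reach_refl)+

lemma run_ret: "run y (ret y 0) = fin"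
  by (induction y) (simp_all add: run_Suc' fin_def)

lemma run_Zero [simp]: "run t 0 = 0"
  by (induction t) (simp_all add: run_Suc)

text \<open>After \<open>fin\<close> the machine is in the trap state 0 forever. Thus a halting
  computation has exactly one halting time, and a code containing this time occurs only once in the
  enumerations below.\<close>

lemma run_fin_unique: "run s z = fin \<Longrightarrow> run t z = fin \<Longrightarrow> s = t"
proof (induction s t rule: linorder_wlog)
  case (le s t)
  show ?case
  proof (rule ccontr)
    assume "s \<noteq> t"
    with le(1) have "t = Suc (t - s - 1) + s" by simp
    then have "run t z = run (Suc (t - s - 1)) fin" using le(2) run_add by metis
    then show False using le(3) by (simp add: run_Suc')
  qed
qed simp

text \<open>The countdown of the returned value takes \<open>y\<close> further steps. This bound is
  what places the items of the enumeration later than the result of the computation causing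
  them.\<close>

lemma evals_halts:
  assumes "evals r xs y"
  shows "\<exists>s\<ge>y. run s (ev (code r) (list_encode xs) 0) = fin"
proof -
  obtain t where "run t (ev (code r) (list_encode xs) 0) = ret y 0"
    using reach_ret[OF assms] unfolding reach_def by blast
  then have "run (y + t) (ev (code r) (list_encode xs) 0) = fin" by (simp add: run_add run_ret)
  then show ?thesis by (metis le_add1)
qed

section \<open>Soundness of the machine: halting runs come from evaluations\<close>

lemma halts_step: "run t z = fin \<Longrightarrow> z \<noteq> fin \<Longrightarrow> \<exists>u<t. run u (step z) = fin"
  by (cases t) (auto simp: run_Suc')

text \<open>The bound \<open>t\<close> makes soundness an induction hypothesis that the lemmas on
  composition and minimisation can take as a premise. The strictly shorter run from
  \<open>ret y K\<close> allows the argument to continue with the pending frame.\<close>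

definition sound_below :: "nat \<Rightarrow> bool" where
  "sound_below t \<longleftrightarrow> (\<forall>s<t. \<forall>r xs K. run s (ev (code r) (list_encode xs) K) = fin \<longrightarrow>
    (\<exists>y. evals r xs y \<and> (\<exists>u<s. run u (ret y K) = fin)))"

lemma sound_belowD:
  assumes "sound_below t" "run s (ev (code r) (list_encode xs) K) = fin" "s < t"
  obtains y u where "evals r xs y" "u < s" "run u (ret y K) = fin"
  using assms unfolding sound_below_def by blast

text \<open>Induction on the inner functions still to be evaluated: \<open>sound_below\<close>
  applies to the first one on top of its frame, and what remains is a shorter run from an
  \<open>args\<close> state with a longer accumulator.\<close>

lemma halts_args_sound:
  assumes "sound_below t" "s < t"
    and "run s (args (code f) (list_encode (map code gs)) (list_encode xs) (list_encode acc) K) = fin"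
  shows "\<exists>ys. list_all2 (\<lambda>g y. evals g xs y) gs ys \<and>
    (\<exists>u<s. run u (ev (code f) (list_encode (rev ys @ acc)) K) = fin)"
  using assms(2,3)
proof (induction gs arbitrary: s acc)
  case Nil
  from halts_step[OF Nil(2)] show ?case by simp
next
  case (Cons g gs)
  let ?K = "comp_frame (code f) (list_encode (map code gs)) (list_encode xs) (list_encode acc) K"
  from halts_step[OF Cons.prems(2)] obtain u where u: "u < s" "run u (ev (code g) (list_encode xs) ?K) = fin"
    by auto
  then obtain y v where y: "evals g xs y" and v: "v < u" "run v (ret y ?K) = fin"
    using sound_belowD[OF assms(1) u(2)] Cons.prems(1) by (metis less_trans)
  from halts_step[OF v(2)] obtain w where w: "w < v"
    "run w (args (code f) (list_encode (map code gs)) (list_encode xs) (list_encode (y # acc)) K) = fin"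
    by auto
  have "w < t" using w v u Cons.prems(1) by simp
  from Cons.IH[OF this w(2)] obtain ys u' where "list_all2 (\<lambda>g y. evals g xs y) gs ys" "u' < w"
    "run u' (ev (code f) (list_encode (rev ys @ y # acc)) K) = fin" by blast
  with y w v u show ?case
    by (intro exI[of _ "y # ys"] conjI exI[of _ u']) auto
qed

text \<open>The search is followed candidate by candidate, by induction on the length of the run.
  The value 0 ends it; a positive value extends the last premise to \<open>Suc n\<close>.\<close>

lemma halts_mu_sound:
  assumes "sound_below t" "s < t"
    and "run s (ev (code f) (list_encode (n # xs)) (mu_frame (code f) (list_encode xs) n K)) = fin"
    and "\<And>m. m < n \<Longrightarrow> \<exists>y>0. evals f (m # xs) y"
  shows "\<exists>y. evals (Mu f) xs y \<and> (\<exists>u<s. run u (ret y K) = fin)"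
  using assms(2-)
proof (induction s arbitrary: n rule: less_induct)
  case (less s)
  let ?K = "mu_frame (code f) (list_encode xs) n K"
  obtain y u where y: "evals f (n # xs) y" and u: "u < s" "run u (ret y ?K) = fin"
    using sound_belowD[OF assms(1) less.prems(2,1)] by metis
  from halts_step[OF u(2)] obtain v where v: "v < u" "run v (step_ret y ?K) = fin"
    by auto
  show ?case
  proof (cases y)
    case 0
    then have "evals (Mu f) xs n" using y less.prems(3) by (intro evals_Mu) auto
    with 0 v u show ?thesis by (intro exI[of _ n] conjI exI[of _ v]) auto
  next
    case (Suc y')
    have "\<exists>y>0. evals f (m # xs) y" if "m < Suc n" for m
      using less.prems(3) y Suc that by (cases "m = n") auto
    with less.IH[of v "Suc n"] v u less.prems(1) Suc
    have "\<exists>y. evals (Mu f) xs y \<and> (\<exists>u<v. run u (ret y K) = fin)" by simp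
    with v u show ?thesis by (metis less_trans)
  qed
qed

lemma sound_below: "sound_below t"
proof (induction t)
  case (Suc t)
  have "\<exists>y. evals r xs y \<and> (\<exists>u<t. run u (ret y K) = fin)"
    if "run t (ev (code r) (list_encode xs) K) = fin" for r xs K
  proof -
    from halts_step[OF that] obtain s where s: "s < t" "run s (step_ev (code r) (list_encode xs) K) = fin"
      by auto
    show ?thesis
    proof (cases r)
      case Zero
      with s show ?thesis by (auto intro: evals_Zero)
    next
      case Succ
      with s show ?thesis by (cases xs) (auto intro: evals_Succ)
    next
      case (Proj i)
      with s show ?thesis by (auto split: if_splits intro: evals_Proj)
    next
      case (Comp f gs)
      with s have "run s (args (code f) (list_encode (map code (rev gs))) (list_encode xs)
          (list_encode []) K) = fin"
        by (simp add: rev_map)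
      from halts_args_sound[OF Suc s(1) this] obtain ys u
        where ys: "list_all2 (\<lambda>g y. evals g xs y) (rev gs) ys" and u: "u < s"
          "run u (ev (code f) (list_encode (rev ys)) K) = fin"
        by auto
      obtain z v where z: "evals f (rev ys) z" and v: "v < u" "run v (ret z K) = fin"
        using sound_belowD[OF Suc u(2)] u(1) s(1) by (metis less_trans)
      have "list_all2 (\<lambda>g y. evals g xs y) gs (rev ys)"
        using ys by (metis list_all2_rev rev_rev_ident)
      then have "evals r xs z" using z Comp by (auto intro: evals_Comp)
      moreover have "v < t" using v u s by simp
      ultimately show ?thesis using v by blast
    next
      case (Prec f g)
      obtain n ys where xs: "xs = n # ys" using s Prec by (cases xs) (auto)
      show ?thesis
      proof (cases n)
        case 0
        with s Prec xs have "run s (ev (code f) (list_encode ys) K) = fin" by simp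
        then obtain z v where z: "evals f ys z" and v: "v < s" "run v (ret z K) = fin"
          using sound_belowD[OF Suc] s(1) by metis
        have "evals r xs z" using z Prec xs 0 by (auto intro: evals_Prec_0)
        moreover have "v < t" using v s by simp
        ultimately show ?thesis using v by blast
      next
        case (Suc m)
        let ?K = "prec_frame (code g) m (list_encode ys) K"
        have "run s (ev (code r) (list_encode (m # ys)) ?K) = fin"
          using s Prec xs Suc by simp
        then obtain y u where y: "evals r (m # ys) y" and u: "u < s" "run u (ret y ?K) = fin"
          using sound_belowD[OF \<open>sound_below t\<close>] s(1) by metis
        from halts_step[OF u(2)] obtain v
          where v: "v < u" "run v (ev (code g) (list_encode (m # y # ys)) K) = fin"
          by auto
        then obtain z w where z: "evals g (m # y # ys) z" and w: "w < v" "run w (ret z K) = fin"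
          using sound_belowD[OF \<open>sound_below t\<close>] s(1) u(1) by (metis less_trans)
        have "evals r xs z" using y z Prec xs Suc by (auto intro: evals_Prec_Suc)
        moreover have "w < t" using w v u s by simp
        ultimately show ?thesis using w by blast
      qed
    next
      case (Mu f)
      with s have "run s (ev (code f) (list_encode (0 # xs)) (mu_frame (code f) (list_encode xs) 0 K)) = fin"
        by simp
      from halts_mu_sound[OF Suc s(1) this] Mu s(1) show ?thesis by (metis less_trans not_less0)
    qed
  qed
  with Suc show ?case unfolding sound_below_def less_Suc_eq by blast
qed (simp add: sound_below_def)

lemma halts_iff: "(\<exists>s. run s (ev (code r) (list_encode xs) 0) = fin) \<longleftrightarrow> (\<exists>y. evals r xs y)"
  using evals_halts sound_belowD[OF sound_below] by (meson lessI)

section \<open>The number attached to a sequence of rates\<close>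

text \<open>Clears denominators: comparisons of finite dyadic sums become comparisons of natural
  numbers and hence decidable.\<close>

lemma dyadic_sum:
  assumes "\<And>k. k < t \<Longrightarrow> h k \<le> M"
  shows "real (\<Sum>k<t. m k * 2 ^ (M - h k)) = 2 ^ M * (\<Sum>k<t. real (m k) * (1 / 2) ^ h k)"
proof -
  have "real (m k * 2 ^ (M - h k)) = 2 ^ M * (real (m k) * (1 / 2) ^ h k)" if "k < t" for k
  proof -
    have "(2 :: real) ^ (M - h k) = 2 ^ M * (1 / 2) ^ h k"
      using assms[OF that] by (simp add: power_diff power_one_over)
    then show ?thesis by simp
  qed
  then show ?thesis by (simp add: sum_distrib_left del: of_nat_mult)
qed

text \<open>Finitely many levels occur among the first \<open>K\<close> indices, and each of their
  partial fibers can be completed. The fibers have to be finite because \<open>card\<close> of an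
  infinite set is 0.\<close>

lemma sum_le_by_level:
  fixes h :: "nat \<Rightarrow> real"
  assumes fin: "\<And>i. finite {k. f k = i}" and h: "\<And>i. h i \<ge> 0"
    and B: "\<And>I. (\<Sum>i<I. real (preimage_count f i) * h i) \<le> B"
  shows "(\<Sum>k<K. h (f k)) \<le> B"
proof -
  obtain I where I: "f ` {..<K} \<subseteq> {..<I}"
    using finite_nat_set_iff_bounded[of "f ` {..<K}"] by auto
  have "(\<Sum>k<K. h (f k)) = (\<Sum>i\<in>f ` {..<K}. \<Sum>k | k \<in> {..<K} \<and> f k = i. h (f k))"
    by (rule sum.image_gen) simp
  also have "\<dots> = (\<Sum>i\<in>f ` {..<K}. real (card {k. k < K \<and> f k = i}) * h i)"
    by simp
  also have "\<dots> \<le> (\<Sum>i\<in>f ` {..<K}. real (preimage_count f i) * h i)"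
    unfolding preimage_count_def
    by (intro sum_mono mult_right_mono h of_nat_mono card_mono fin) auto
  also have "\<dots> \<le> (\<Sum>i<I. real (preimage_count f i) * h i)"
    by (intro sum_mono2 I mult_nonneg_nonneg h) auto
  finally show ?thesis using B[of I] by simp
qed

locale rate =
  fixes p q :: "nat \<Rightarrow> nat"
  assumes computable_p: "computable p" and computable_q: "computable q"
begin

text \<open>Up to cleared denominators, \<open>b\<close> lies below \<open>n\<^sup>2 * (1 + (p n / (q n + 1)) ^ n)\<close>, which grows
  like the \<open>n\<close>-th power of the limit of the rates.  The polynomial factor leaves room for the
  rate \<open>1\<close>; the second bound makes the series converge computably at the rate \<open>2\<close>.\<close>

definition admissible :: "nat \<Rightarrow> nat \<Rightarrow> bool" where
  "admissible n b \<longleftrightarrow> b * Suc (q n) ^ n < n\<^sup>2 * (Suc (q n) ^ n + p n ^ n) \<and> Suc b * Suc n ^ 3 \<le> 2 ^ n"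

text \<open>The index \<open>k\<close> codes a level \<open>n\<close>, a program \<open>a\<close>, an advice \<open>b\<close> and a running time.\<close>

definition hit :: "nat \<Rightarrow> bool" where
  "hit k \<longleftrightarrow> p2 (p1 k) < p1 (p1 k) \<and> admissible (p1 (p1 k)) (p1 (p2 k)) \<and>
    run (p2 (p2 k)) (ev (p2 (p1 k)) (consn (pr (p1 (p1 k)) (p1 (p2 k))) 0) 0) = fin"

definition enum :: "nat \<Rightarrow> nat" where
  "enum k = (if hit k then p1 (p1 k) else k)"

lemma computable_enum: "computable enum"
  unfolding enum_def[abs_def] hit_def admissible_def ev_def consn_def power2_eq_square
  by (intro computable_intros computable_run computable_compose[OF computable_p]
      computable_compose[OF computable_q])

lemma admissible_subset: "{b. admissible n b} \<subseteq> {..<2 ^ n div Suc n ^ 3}"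
proof
  fix b assume "b \<in> {b. admissible n b}"
  then have "Suc b * Suc n ^ 3 \<le> 2 ^ n" by (simp add: admissible_def)
  then have "Suc b \<le> 2 ^ n div Suc n ^ 3"
    by (subst less_eq_div_iff_mult_less_eq) auto
  then show "b \<in> {..<2 ^ n div Suc n ^ 3}" by simp
qed

lemma finite_admissible: "finite {b. admissible n b}"
  using admissible_subset by (rule finite_subset) simp

lemma card_admissible: "card {b. admissible n b} * Suc n ^ 3 \<le> 2 ^ n"
proof -
  have "card {b. admissible n b} \<le> 2 ^ n div Suc n ^ 3"
    using card_mono[OF _ admissible_subset[of n]] by simp
  then show ?thesis
    by (subst (asm) less_eq_div_iff_mult_less_eq) auto
qed

lemma card_admissible_rate:
  "real (card {b. admissible n b}) \<le> real n ^ 2 * (1 + (real (p n) / real (Suc (q n))) ^ n) + 1"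
proof -
  define y where "y = real n ^ 2 * (1 + (real (p n) / real (Suc (q n))) ^ n)"
  have y0: "y \<ge> 0" unfolding y_def by (intro mult_nonneg_nonneg add_nonneg_nonneg) auto
  have "b < nat \<lceil>y\<rceil>" if "admissible n b" for b
  proof -
    have "real (b * Suc (q n) ^ n) < real (n\<^sup>2 * (Suc (q n) ^ n + p n ^ n))"
      using that unfolding admissible_def of_nat_less_iff by blast
    then have "real b * real (Suc (q n)) ^ n < real n ^ 2 * (real (Suc (q n)) ^ n + real (p n) ^ n)"
      by (simp only: of_nat_mult of_nat_add of_nat_power)
    also have "\<dots> = y * real (Suc (q n)) ^ n"
      unfolding y_def by (simp add: power_divide field_simps del: of_nat_Suc)
    finally have "real b < y" by (simp add: mult_less_cancel_right del: of_nat_Suc)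
    then show ?thesis by linarith
  qed
  then have "{b. admissible n b} \<subseteq> {..<nat \<lceil>y\<rceil>}" by auto
  from card_mono[OF _ this] have "card {b. admissible n b} \<le> nat \<lceil>y\<rceil>" by simp
  then have "real (card {b. admissible n b}) \<le> real (nat \<lceil>y\<rceil>)" by simp
  also have "\<dots> \<le> y + 1" using y0 by linarith
  finally show ?thesis unfolding y_def .
qed

text \<open>By uniqueness of halting times, a hit of level \<open>n\<close> is determined by its
  program and its advice; there are at most \<open>n\<close> programs. The additional 1 accounts for
  the index \<open>n\<close> itself, which may be a filler.\<close>

lemma enum_fiber:
  "finite {k. enum k = n}" "preimage_count enum n \<le> Suc (n * card {b. admissible n b})"
proof -
  let ?H = "{k. hit k \<and> p1 (p1 k) = n}" and ?T = "{..<n} \<times> {b. admissible n b}"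
  have inj: "inj_on (\<lambda>k. (p2 (p1 k), p1 (p2 k))) ?H"
  proof (rule inj_onI, clarsimp)
    fix k l
    assume kl: "hit k" "hit l" "p1 (p1 l) = p1 (p1 k)" "p2 (p1 k) = p2 (p1 l)" "p1 (p2 k) = p1 (p2 l)"
    then have "p2 (p2 k) = p2 (p2 l)"
      unfolding hit_def by (metis run_fin_unique)
    with kl show "k = l" by (metis pr_p1_p2)
  qed
  have sub: "(\<lambda>k. (p2 (p1 k), p1 (p2 k))) ` ?H \<subseteq> ?T"
    by (auto simp: hit_def)
  have finT: "finite ?T" using finite_admissible by simp
  have finH: "finite ?H" using inj_on_finite[OF inj sub finT] .
  have "{k. enum k = n} \<subseteq> insert n ?H" by (auto simp: enum_def)
  then show "finite {k. enum k = n}" using finH finite_subset by blast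
  have "preimage_count enum n \<le> card (insert n ?H)"
    unfolding preimage_count_def using \<open>{k. enum k = n} \<subseteq> insert n ?H\<close> finH by (intro card_mono) auto
  also have "\<dots> \<le> Suc (card ?H)" using finH by (simp add: card_insert_if)
  also have "card ?H \<le> card ?T" by (rule card_inj_on_le[OF inj sub finT])
  finally show "preimage_count enum n \<le> Suc (n * card {b. admissible n b})"
    by (simp add: card_cartesian_product)
qed

section \<open>Computable convergence of the series over the levels\<close>

definition tail_bound :: "nat \<Rightarrow> real" where
  "tail_bound k = 2 * (1 / 2) ^ k + 2 / real (Suc k)"

lemma tail_bound_le: "0 \<le> tail_bound k" "tail_bound k \<le> 4 / real (Suc k)"
proof -
  have "Suc k \<le> 2 ^ k" by (induction k) auto
  then have "real (Suc k) \<le> 2 ^ k" by (metis of_nat_le_iff of_nat_numeral of_nat_power)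
  then have "(1 / 2) ^ k \<le> 1 / real (Suc k)"
    by (simp add: power_one_over frac_le del: of_nat_Suc)
  then show "tail_bound k \<le> 4 / real (Suc k)" unfolding tail_bound_def by simp
qed (simp add: tail_bound_def)

text \<open>The filler weighs at most 2^-k, the hits at most k / (k+1)^3, hence at most 2 /
  ((k+1)(k+2)). The sum of both bounds is the difference of consecutive values of
  \<open>tail_bound\<close>, so the estimate telescopes.\<close>

lemma level_weight: "real (preimage_count enum k) * (1 / 2) ^ k \<le> tail_bound k - tail_bound (Suc k)"
proof -
  let ?c = "card {b. admissible k b}"
  have "real (preimage_count enum k) \<le> 1 + real k * real ?c"
    using enum_fiber(2)[of k] by (metis of_nat_1 of_nat_add of_nat_le_iff of_nat_mult plus_1_eq_Suc)
  then have "real (preimage_count enum k) * (1 / 2) ^ k \<le> (1 + real k * real ?c) * (1 / 2) ^ k"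
    by (intro mult_right_mono) auto
  also have "\<dots> = (1 / 2) ^ k + real k * (real ?c * (1 / 2) ^ k)" by (simp add: algebra_simps)
  also have "real (?c * Suc k ^ 3) \<le> real (2 ^ k)" using card_admissible[of k] by (simp only: of_nat_le_iff)
  then have "real ?c * real (Suc k) ^ 3 \<le> 2 ^ k" by (simp only: of_nat_mult of_nat_power of_nat_numeral)
  then have "real ?c * (1 / 2) ^ k \<le> 1 / real (Suc k) ^ 3"
    by (simp add: power_one_over field_simps del: of_nat_Suc)
  then have "real k * (real ?c * (1 / 2) ^ k) \<le> real (Suc k) * (1 / real (Suc k) ^ 3)"
    by (intro mult_mono) auto
  also have "\<dots> = 1 / real (Suc k) ^ 2"
    by (simp add: power2_eq_square power3_eq_cube del: of_nat_Suc)
  also have "\<dots> \<le> 2 / (real (Suc k) * real (Suc (Suc k)))"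
    by (simp add: power2_eq_square divide_simps del: of_nat_Suc) simp
  also have "\<dots> = 2 / real (Suc k) - 2 / real (Suc (Suc k))"
    by (simp add: divide_simps)
  finally show ?thesis unfolding tail_bound_def by simp
qed

lemma level_sum:
  assumes "m \<le> n"
  shows "(\<Sum>k=m..<n. real (preimage_count enum k) * (1 / 2) ^ k) \<le> tail_bound m"
proof -
  have "(\<Sum>k=m..<n. real (preimage_count enum k) * (1 / 2) ^ k) \<le>
      (\<Sum>k=m..<n. tail_bound k - tail_bound (Suc k))"
    by (intro sum_mono level_weight)
  also have "\<dots> = tail_bound m - tail_bound n"
    using sum_Suc_diff'[OF assms, of "\<lambda>k. - tail_bound k"] by simp
  finally show ?thesis using tail_bound_le(1)[of n] by linarith
qed

lemma summable_enum: "summable (\<lambda>k. (1 / 2 :: real) ^ enum k)"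
proof (rule summableI_nonneg_bounded)
  show "(\<Sum>k<K. (1 / 2 :: real) ^ enum k) \<le> tail_bound 0" for K
    using level_sum[of 0]
    by (intro sum_le_by_level[of enum "\<lambda>i. (1 / 2) ^ i"] enum_fiber(1)) (auto simp: lessThan_atLeast0)
qed simp

definition value_enum :: real where
  "value_enum = (\<Sum>k. (1 / 2) ^ enum k)"

lemma is_name_enum: "is_name enum value_enum"
  unfolding is_name_def value_enum_def using summable_enum by (rule summable_sums)

lemma series_converges_computably_enum:
  "series_converges_computably (\<lambda>k. real (preimage_count enum k) * (1 / 2) ^ k)"
proof -
  let ?a = "\<lambda>k. real (preimage_count enum k) * (1 / 2) ^ k"
  have summ: "summable ?a"
    using level_sum[of 0] by (intro summableI_nonneg_bounded) (auto simp: lessThan_atLeast0)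
  \<comment> \<open>The modulus 2^(n+2) comes from the bound 4 / (k+1) on the tail starting at
    \<open>k\<close>.\<close>
  have "\<bar>suminf ?a - (\<Sum>i<k. ?a i)\<bar> \<le> (1 / 2) ^ n" if k: "2 ^ (n + 2) \<le> k" for n k
  proof -
    have "(\<Sum>i<l. ?a i) \<le> (\<Sum>i<k. ?a i) + tail_bound k" if "k \<le> l" for l
      using level_sum[OF that] sum.atLeastLessThan_concat[of 0 k l ?a] that
      by (simp add: lessThan_atLeast0)
    then have "suminf ?a \<le> (\<Sum>i<k. ?a i) + tail_bound k"
      using summable_LIMSEQ[OF summ] by (intro LIMSEQ_le_const2) auto
    moreover have "(\<Sum>i<k. ?a i) \<le> suminf ?a"
      by (intro sum_le_suminf summ) auto
    moreover have "tail_bound k \<le> (1 / 2) ^ n"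
    proof -
      have "real (2 ^ (n + 2)) \<le> real k" using k by (simp only: of_nat_le_iff)
      then have "4 / real (Suc k) \<le> 4 / 2 ^ (n + 2)" by (intro divide_left_mono) auto
      then show ?thesis using tail_bound_le(2)[of k] by (simp add: power_one_over)
    qed
    ultimately show ?thesis by linarith
  qed
  moreover have "computable (\<lambda>n. 2 ^ (n + 2))" by (intro computable_intros)
  ultimately show ?thesis
    using summable_LIMSEQ[OF summ]
    unfolding series_converges_computably_def converges_computably_def by blast
qed

lemma reordered_computable_value: "reordered_computable value_enum"
  using computable_enum is_name_enum series_converges_computably_enum
  unfolding reordered_computable_def by blast

section \<open>The diagonal argument against weighted names\<close>

lemma program_input_halts:
  assumes "evals r [pr n b] y" "code r < n" "admissible n b"
  shows "\<exists>k\<ge>y. enum k = n"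
proof -
  obtain s where s: "s \<ge> y" "run s (ev (code r) (list_encode [pr n b]) 0) = fin"
    using evals_halts[OF assms(1)] by blast
  \<comment> \<open>The running time is the innermost second component, so the index is at least
    \<open>s\<close> and therefore at least \<open>y\<close>.\<close>
  let ?k = "pr (pr n (code r)) (pr b s)"
  have "hit ?k" using assms(2,3) s(2) by (simp add: hit_def)
  moreover have "y \<le> ?k" using s(1) le_pr2 order_trans by metis
  ultimately show ?thesis by (intro exI[of _ ?k]) (simp add: enum_def)
qed

lemma value_enum_ge:
  assumes "enum k = n" "K \<le> k"
  shows "(\<Sum>i<K. (1 / 2) ^ enum i) + (1 / 2) ^ n \<le> value_enum"
proof -
  have "(\<Sum>i<K. (1 / 2) ^ enum i) + (1 / 2 :: real) ^ n = (\<Sum>i\<in>insert k {..<K}. (1 / 2) ^ enum i)"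
    using assms by simp
  also have "\<dots> \<le> value_enum"
    unfolding value_enum_def using summable_enum by (intro sum_le_suminf) auto
  finally show ?thesis .
qed

text \<open>The truncated subtraction counts an item of level at most \<open>Suc n\<close> as \<open>1\<close> and an item of
  higher level by its weight relative to level \<open>Suc n\<close>.  The multiplicities \<open>m\<close> may be \<open>0\<close>, so
  that sums over computably enumerable sets are covered.\<close>

lemma advice_not_admissible:
  assumes m: "computable m" and g: "computable g"
    and sums: "(\<lambda>k. real (m k) * (1 / 2) ^ g k) sums value_enum"
  shows "\<exists>n0. \<forall>n>n0. \<forall>B. (\<forall>t. (\<Sum>k<t. real (m k) * (1 / 2) ^ (g k - Suc n)) \<le> B) \<longrightarrow>
    (\<exists>b. real b \<le> B \<and> \<not> admissible n b)"
proof -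
  \<comment> \<open>An upper bound for all levels involved: multiplication by
    \<open>2 ^ M n t K\<close> makes every term of \<open>Q\<close> a natural number, and none of
    the subtractions from it is truncated.\<close>
  define M where "M n t K = (\<Sum>k<t. g k) + (\<Sum>k<K. enum k) + Suc n" for n t K
  \<comment> \<open>Cleared of denominators: the first \<open>t\<close> items have relative weight
    at least \<open>N\<close>, and their sum is less than 2^-(n+1) above the \<open>K\<close>-th
    partial sum of \<open>enum\<close>.\<close>
  define Q where "Q n N t K \<longleftrightarrow>
    N * 2 ^ M n t K \<le> (\<Sum>k<t. m k * 2 ^ (M n t K - (g k - Suc n))) \<and>
    (\<Sum>k<t. m k * 2 ^ (M n t K - g k)) < (\<Sum>k<K. 1 * 2 ^ (M n t K - enum k)) + 2 ^ (M n t K - Suc n)"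
    for n N t K
  \<comment> \<open>The value searched for is the pair of the stages \<open>t\<close> and
    \<open>K\<close>; the input is the level \<open>n\<close> with the advice
    \<open>N\<close>.\<close>
  define P where "P w = Q (p1 (p2 w)) (p2 (p2 w)) (p1 (p1 w)) (p2 (p1 w))" for w
  have "decidable P"
    unfolding P_def[abs_def] Q_def M_def
    by (intro computable_intros computable_compose[OF m] computable_compose[OF g]
        computable_compose[OF computable_enum])
  from search_program[OF this]
  obtain r where r: "\<And>b z. P (pr z b) \<Longrightarrow> \<exists>y. evals r [b] y \<and> P (pr y b)" by blast
  define \<Phi> where "\<Phi> n t = (\<Sum>k<t. real (m k) * (1 / 2) ^ (g k - Suc n))" for n t
  define G where "G t = (\<Sum>k<t. real (m k) * (1 / 2) ^ g k)" for t
  define X where "X K = (\<Sum>k<K. (1 / 2 :: real) ^ enum k)" for K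
  have Q_iff: "Q n N t K \<longleftrightarrow> real N \<le> \<Phi> n t \<and> G t < X K + (1 / 2) ^ Suc n" for n N t K
  proof -
    let ?M = "M n t K"
    have g_le: "g k \<le> ?M" if "k < t" for k
      using member_le_sum[of k "{..<t}" g] that by (simp add: M_def)
    have enum_le: "enum k \<le> ?M" if "k < K" for k
      using member_le_sum[of k "{..<K}" enum] that by (simp add: M_def)
    have "real (\<Sum>k<t. m k * 2 ^ (?M - (g k - Suc n))) = 2 ^ ?M * \<Phi> n t"
      unfolding \<Phi>_def using g_le by (intro dyadic_sum) (meson diff_le_self order_trans)
    moreover have "real (\<Sum>k<t. m k * 2 ^ (?M - g k)) = 2 ^ ?M * G t"
      unfolding G_def using g_le by (intro dyadic_sum)
    moreover have "real (\<Sum>k<K. 1 * 2 ^ (?M - enum k)) = 2 ^ ?M * X K"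
      unfolding X_def using dyadic_sum[of K enum ?M "\<lambda>_. 1"] enum_le by simp
    moreover have "real (2 ^ (?M - Suc n)) = 2 ^ ?M * (1 / 2) ^ Suc n"
      by (simp add: M_def power_add power_one_over)
    ultimately have "Q n N t K \<longleftrightarrow> 2 ^ ?M * real N \<le> 2 ^ ?M * \<Phi> n t \<and>
        2 ^ ?M * G t < 2 ^ ?M * (X K + (1 / 2) ^ Suc n)"
      unfolding Q_def of_nat_le_iff[where 'a = real, symmetric] of_nat_less_iff[where 'a = real, symmetric]
      by (simp only: of_nat_add of_nat_mult of_nat_power of_nat_numeral distrib_left mult.commute)
    then show ?thesis by simp
  qed
  have "\<exists>b. real b \<le> B \<and> \<not> admissible n b" if n: "n > code r" and B: "\<And>t. \<Phi> n t \<le> B" for n B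
  proof -
    \<comment> \<open>The largest natural number reached by the relative weight at some finite
      stage. Such a stage exists because the maximum is attained, and it can be recognised once
      \<open>N\<close> is known.\<close>
    define N where "N = Max {N. \<exists>t. real N \<le> \<Phi> n t}"
    have "{N. \<exists>t. real N \<le> \<Phi> n t} \<subseteq> {..nat \<lfloor>B\<rfloor>}"
      using B by (auto intro!: le_nat_floor intro: order_trans)
    then have fin: "finite {N. \<exists>t. real N \<le> \<Phi> n t}" by (rule finite_subset) simp
    have "0 \<in> {N. \<exists>t. real N \<le> \<Phi> n t}" by (auto simp: \<Phi>_def intro!: exI[of _ 0])
    with fin have "N \<in> {N. \<exists>t. real N \<le> \<Phi> n t}" unfolding N_def by (intro Max_in) blast+
    then obtain t where t: "real N \<le> \<Phi> n t" by auto
    have N_max: "\<Phi> n T < real N + 1" for T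
    proof (rule ccontr)
      assume "\<not> \<Phi> n T < real N + 1"
      then have "Suc N \<in> {N. \<exists>t. real N \<le> \<Phi> n t}" by (auto intro!: exI[of _ T])
      then have "Suc N \<le> N" unfolding N_def using fin by (intro Max_ge)
      then show False by simp
    qed
    have "\<not> admissible n N"
    proof
      assume adm: "admissible n N"
      have G_le: "G t \<le> value_enum" for t
        unfolding G_def sums_unique[OF sums] using sums
        by (intro sum_le_suminf) (auto simp: sums_iff)
      have "X \<longlonglongrightarrow> value_enum"
        using is_name_enum unfolding is_name_def sums_def X_def[abs_def] .
      then have "\<forall>\<^sub>F K in sequentially. value_enum - (1 / 2) ^ Suc n < X K"
        by (rule order_tendstoD) simp
      then obtain K where "value_enum - (1 / 2) ^ Suc n < X K"
        by (auto simp: eventually_sequentially)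
      \<comment> \<open>The search succeeds: at a late stage \<open>K\<close> the sum of
        \<open>enum\<close> is within 2^-(n+1) of the limit, which bounds
        \<open>G t\<close>.\<close>
      with G_le[of t] have "P (pr (pr t K) (pr n N))" using t by (simp add: P_def Q_iff)
      then obtain y where y: "evals r [pr n N] y" "P (pr y (pr n N))" using r by blast
      define t' K' where "t' = p1 y" and "K' = p2 y"
      have t': "real N \<le> \<Phi> n t'" and K': "G t' < X K' + (1 / 2) ^ Suc n"
        using y(2) by (simp_all add: P_def Q_iff t'_def K'_def)
      \<comment> \<open>After stage \<open>t'\<close> relative weight less than 1 remains. An item
        of level at most \<open>n\<close> would already count 1, so all later items have level at
        least \<open>Suc n\<close>, where relative weight times 2^-(n+1) is the true weight.\<close>
      have "G T \<le> G t' + (1 / 2) ^ Suc n" if "t' \<le> T" for T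
      proof -
        let ?h = "\<lambda>k. real (m k) * (1 / 2) ^ (g k - Suc n)"
        have split: "(\<Sum>k<T. f k) = (\<Sum>k<t'. f k) + (\<Sum>k=t'..<T. f k)" for f :: "nat \<Rightarrow> real"
          using sum.atLeastLessThan_concat[of 0 t' T f] that by (simp add: lessThan_atLeast0)
        have less_1: "(\<Sum>k=t'..<T. ?h k) < 1"
          using N_max[of T] t' split[of ?h] unfolding \<Phi>_def by linarith
        have "real (m k) * (1 / 2) ^ g k \<le> (1 / 2) ^ Suc n * ?h k" if k: "k \<in> {t'..<T}" for k
        proof (cases "m k = 0 \<or> Suc n \<le> g k")
          case True
          then have "m k = 0 \<or> (1 / 2 :: real) ^ g k = (1 / 2) ^ Suc n * (1 / 2) ^ (g k - Suc n)"
            by (metis le_add_diff_inverse power_add)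
          then show ?thesis by (auto simp only: mult.left_commute mult_zero_left of_nat_0 order_refl)
        next
          case False
          then have "1 \<le> ?h k" by simp
          also have "?h k \<le> (\<Sum>k=t'..<T. ?h k)"
            using k by (intro member_le_sum) auto
          finally show ?thesis using less_1 by simp
        qed
        then have "(\<Sum>k=t'..<T. real (m k) * (1 / 2) ^ g k) \<le> (\<Sum>k=t'..<T. (1 / 2) ^ Suc n * ?h k)"
          by (rule sum_mono)
        also have "\<dots> = (1 / 2) ^ Suc n * (\<Sum>k=t'..<T. ?h k)" by (simp only: sum_distrib_left)
        also have "\<dots> \<le> (1 / 2) ^ Suc n * 1" using less_1 by (intro mult_left_mono) auto
        finally show ?thesis unfolding G_def split by simp
      qed
      moreover have "G \<longlonglongrightarrow> value_enum" using sums unfolding sums_def G_def[abs_def] .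
      ultimately have "value_enum \<le> G t' + (1 / 2) ^ Suc n" by (intro LIMSEQ_le_const2) auto
      \<comment> \<open>Two errors of 2^-(n+1) add up to 2^-n, exactly the weight of one item of
        level \<open>n\<close>.\<close>
      with K' have less: "value_enum < X K' + (1 / 2) ^ n" by simp
      \<comment> \<open>Such an item is produced by the search program itself, after its result
        \<open>y\<close> and hence after stage \<open>K'\<close>.\<close>
      obtain k where "k \<ge> y" "enum k = n" using program_input_halts[OF y(1) n adm] by blast
      moreover have "K' \<le> y" unfolding K'_def using le_pr2[of "p2 y" "p1 y"] by simp
      ultimately have "X K' + (1 / 2) ^ n \<le> value_enum"
        unfolding X_def by (intro value_enum_ge[of k]) auto
      with less show False by simp
    qed
    moreover have "real N \<le> B" using t B[of t] by simp
    ultimately show ?thesis by blast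
  qed
  then show ?thesis unfolding \<Phi>_def by blast
qed

end

section \<open>Growth rates\<close>

text \<open>The first \<open>m\<close> exponents are truncated to 0 and contribute \<open>m\<close>;
  the remaining terms form a geometric series.\<close>

lemma sum_power_diff_le:
  fixes x :: real
  assumes "0 \<le> x" "x < 1"
  shows "(\<Sum>i<I. x ^ (i - m)) \<le> real m + 1 / (1 - x)"
proof -
  have "(\<Sum>i<I. x ^ (i - m)) \<le> (\<Sum>i<m + I. x ^ (i - m))"
    using assms by (intro sum_mono2) auto
  also have "\<dots> = (\<Sum>i<m. x ^ (i - m)) + (\<Sum>i<I. x ^ i)"
    by (induction I) auto
  also have "(\<Sum>i<I. x ^ i) \<le> 1 / (1 - x)"
    using assms sum_le_suminf[of "\<lambda>i. x ^ i" "{..<I}"] by (simp add: suminf_geometric summable_geometric)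
  finally show ?thesis by simp
qed

lemma finite_name_fiber:
  assumes "is_name g x" shows "finite {k. g k = i}"
proof -
  have "(\<lambda>k. (1 / 2 :: real) ^ g k) \<longlonglongrightarrow> 0"
    using assms unfolding is_name_def by (intro summable_LIMSEQ_zero) (auto simp: sums_iff)
  then have "\<forall>\<^sub>F k in sequentially. (1 / 2 :: real) ^ g k < (1 / 2) ^ i"
    by (rule order_tendstoD) simp
  then obtain K where "\<And>k. k \<ge> K \<Longrightarrow> (1 / 2 :: real) ^ g k < (1 / 2) ^ i"
    by (auto simp: eventually_sequentially)
  then have "{k. g k = i} \<subseteq> {..<K}" by (metis (mono_tags) lessThan_iff less_irrefl mem_Collect_eq not_le subsetI)
  then show ?thesis by (rule finite_subset) simp
qed

text \<open>Almost all counts are below \<open>\<sigma> ^ n\<close>; the finitely many others are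
  absorbed by \<open>C\<close>, since \<open>\<sigma> ^ n\<close> is at least 1.\<close>

lemma growth_bound:
  assumes less: "growth g < ereal \<sigma>" and \<sigma>: "\<sigma> \<ge> 1"
  obtains C where "C \<ge> 0" "\<And>n. real (preimage_count g n) \<le> C * \<sigma> ^ n"
proof -
  have "\<forall>\<^sub>F n in sequentially. ereal (root n (real (preimage_count g n))) < ereal \<sigma>"
    using less unfolding growth_def by (rule Limsup_lessD)
  then obtain n1 where n1: "\<And>n. n \<ge> n1 \<Longrightarrow> root n (real (preimage_count g n)) < \<sigma>"
    by (auto simp: eventually_sequentially)
  define C where "C = 1 + (\<Sum>n<Suc n1. real (preimage_count g n))"
  have C: "C \<ge> 1" unfolding C_def by (simp add: sum_nonneg)
  have "real (preimage_count g n) \<le> C * \<sigma> ^ n" for n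
  proof (cases "n \<le> n1")
    case True
    have "real (preimage_count g n) \<le> (\<Sum>n<Suc n1. real (preimage_count g n))"
      using True by (intro member_le_sum) auto
    also have "\<dots> \<le> C * 1" by (simp add: C_def)
    also have "\<dots> \<le> C * \<sigma> ^ n" using \<sigma> C by (intro mult_left_mono) auto
    finally show ?thesis .
  next
    case False
    then have "real (preimage_count g n) = root n (real (preimage_count g n)) ^ n" by simp
    also have "\<dots> \<le> \<sigma> ^ n" using n1[of n] False by (intro power_mono) auto
    also have "\<dots> \<le> C * \<sigma> ^ n" using \<sigma> C by simp
    finally show ?thesis .
  qed
  with C show thesis by (intro that[of C]) auto
qed

text \<open>Each level up to \<open>n\<close> contributes at most
  \<open>C * \<sigma> ^ Suc n\<close>, and beyond it the contributions decay with ratio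
  \<open>\<sigma> / 2\<close>, which is less than 1.\<close>

lemma level_weights_bound:
  fixes \<sigma> :: real
  assumes \<sigma>: "1 \<le> \<sigma>" "\<sigma> < 2" and C: "C \<ge> 0"
  obtains D where "D \<ge> 0"
    "\<And>n I. (\<Sum>i<I. C * \<sigma> ^ i * (1 / 2) ^ (i - Suc n)) \<le> D * (real n + 3) * \<sigma> ^ n"
proof
  define E where "E = 1 / (1 - \<sigma> / 2)"
  have E: "E \<ge> 0" using \<sigma> by (simp add: E_def)
  show "C * \<sigma> * (1 + E) \<ge> 0" using \<sigma> C E by simp
  fix n I
  have "C * \<sigma> ^ i * (1 / 2) ^ (i - Suc n) \<le> C * \<sigma> ^ Suc n * (\<sigma> / 2) ^ (i - Suc n)" for i
  proof -
    have "\<sigma> ^ i \<le> \<sigma> ^ (Suc n + (i - Suc n))" using \<sigma> by (intro power_increasing) auto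
    then have "C * \<sigma> ^ i * (1 / 2) ^ (i - Suc n) \<le> C * \<sigma> ^ (Suc n + (i - Suc n)) * (1 / 2) ^ (i - Suc n)"
      using C by (intro mult_right_mono mult_left_mono) auto
    also have "\<dots> = C * \<sigma> ^ Suc n * (\<sigma> / 2) ^ (i - Suc n)"
      by (simp add: power_add power_divide)
    finally show ?thesis .
  qed
  then have "(\<Sum>i<I. C * \<sigma> ^ i * (1 / 2) ^ (i - Suc n)) \<le>
      (\<Sum>i<I. C * \<sigma> ^ Suc n * (\<sigma> / 2) ^ (i - Suc n))"
    by (rule sum_mono)
  also have "\<dots> = C * \<sigma> ^ Suc n * (\<Sum>i<I. (\<sigma> / 2) ^ (i - Suc n))"
    by (simp only: sum_distrib_left)
  also have "\<dots> \<le> C * \<sigma> ^ Suc n * (real (Suc n) + E)"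
    unfolding E_def using \<sigma> C by (intro mult_left_mono sum_power_diff_le) auto
  also have "\<dots> \<le> C * \<sigma> ^ Suc n * ((1 + E) * (real n + 3))"
    using \<sigma> C E by (intro mult_left_mono) (auto simp: algebra_simps)
  finally show "(\<Sum>i<I. C * \<sigma> ^ i * (1 / 2) ^ (i - Suc n)) \<le> C * \<sigma> * (1 + E) * (real n + 3) * \<sigma> ^ n"
    by (simp add: mult_ac)
qed

lemma computable_sum_list:
  "(\<And>c. c \<in> set cs \<Longrightarrow> computable (F c)) \<Longrightarrow> computable (\<lambda>k. \<Sum>c\<leftarrow>cs. F c k)"
  by (induction cs) (auto intro!: computable_intros)

section \<open>Regular numbers as sums with computable multiplicities\<close>

definition halting_time :: "nat \<Rightarrow> nat \<Rightarrow> bool" where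
  "halting_time c k \<longleftrightarrow> run (p2 k) (ev c (consn (p1 k) 0) 0) = fin"

lemma decidable_halting_time: "decidable (halting_time c)"
  unfolding halting_time_def[abs_def] ev_def consn_def
  by (intro computable_intros computable_run)

lemma inj_on_halting_time: "inj_on p1 {k. halting_time c k}"
proof (rule inj_onI, clarsimp)
  fix k l assume "halting_time c k" "halting_time c l" "p1 k = p1 l"
  moreover from this have "p2 k = p2 l" unfolding halting_time_def by (metis run_fin_unique)
  ultimately show "k = l" by (metis pr_p1_p2)
qed

lemma image_halting_time: "p1 ` {k. halting_time (code r) k} = {n. \<exists>y. evals r [n] y}"
proof -
  have "n \<in> p1 ` {k. halting_time (code r) k} \<longleftrightarrow> (\<exists>s. run s (ev (code r) (list_encode [n]) 0) = fin)" for n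
    by (auto simp: halting_time_def image_iff) (metis p1_pr p2_pr)
  then show ?thesis unfolding halts_iff by blast
qed

text \<open>The first projection maps the decidable set of pairs of an input and its halting time
  bijectively onto the enumerable set. The series thus gets computable terms, with multiplicity 0
  for the other pairs.\<close>

lemma halting_time_sums:
  assumes "((\<lambda>n. (1 / 2) ^ (n + 1)) has_sum y) {n. \<exists>y. evals r [n] y}"
  shows "(\<lambda>k. of_bool (halting_time (code r) k) * (1 / 2 :: real) ^ Suc (p1 k)) sums y"
proof -
  have "((\<lambda>n. (1 / 2 :: real) ^ (n + 1)) \<circ> p1 has_sum y) {k. halting_time (code r) k}"
    using assms unfolding image_halting_time[symmetric]
    by (subst has_sum_reindex[symmetric]) (rule inj_on_halting_time)
  then have "((\<lambda>k. of_bool (halting_time (code r) k) * (1 / 2 :: real) ^ Suc (p1 k)) has_sum y) UNIV"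
    by (subst has_sum_cong_neutral) auto
  then show ?thesis by (rule has_sum_imp_sums)
qed

text \<open>By injectivity each level occurs at most once: inputs below \<open>n\<close> contribute
  at most \<open>n\<close>, the others at most the geometric sum 2.\<close>

lemma halting_time_weights:
  "(\<Sum>k<t. of_bool (halting_time c k) * (1 / 2 :: real) ^ (Suc (p1 k) - Suc n)) \<le> real n + 2"
proof -
  let ?H = "{k. k < t \<and> halting_time c k}"
  obtain I where I: "p1 ` ?H \<subseteq> {..<I}"
    using finite_nat_set_iff_bounded[of "p1 ` ?H"] by auto
  have inj: "inj_on p1 ?H"
    using inj_on_halting_time by (rule inj_on_subset) auto
  have "(\<Sum>k<t. of_bool (halting_time c k) * (1 / 2 :: real) ^ (Suc (p1 k) - Suc n)) =
      (\<Sum>k\<in>?H. (1 / 2) ^ (p1 k - n))"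
    by (intro sum.mono_neutral_cong_right) auto
  also have "\<dots> = (\<Sum>i\<in>p1 ` ?H. (1 / 2) ^ (i - n))"
    using sum.reindex[OF inj, of "\<lambda>i. (1 / 2 :: real) ^ (i - n)"] by simp
  also have "\<dots> \<le> (\<Sum>i<I. (1 / 2) ^ (i - n))"
    by (intro sum_mono2 I) auto
  also have "\<dots> \<le> real n + 2"
    using sum_power_diff_le[of "1 / 2" n I] by simp
  finally show ?thesis .
qed

text \<open>All summands share the level function \<open>Suc (p1 k)\<close>; the multiplicity is the
  number of summands for which \<open>k\<close> codes a halting run. The bound adds up over the
  \<open>L\<close> summands.\<close>

lemma regular_weighted_name:
  assumes "regular x"
  obtains m g L where "computable m" "computable g" "(\<lambda>k. real (m k) * (1 / 2) ^ g k) sums x"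
    "\<And>n t. (\<Sum>k<t. real (m k) * (1 / 2) ^ (g k - Suc n)) \<le> real L * (real n + 2)"
proof -
  obtain ys where ys: "\<And>y. y \<in> set ys \<Longrightarrow> strongly_left_computable y" "x = sum_list ys"
    using assms unfolding regular_def by blast
  then have "\<forall>y\<in>set ys. \<exists>r. ((\<lambda>n. (1 / 2) ^ (n + 1)) has_sum y) {n. \<exists>y. evals r [n] y}"
    unfolding strongly_left_computable_def comp_enumerable_def by blast
  then obtain r where r: "\<And>y. y \<in> set ys \<Longrightarrow>
      ((\<lambda>n. (1 / 2) ^ (n + 1)) has_sum y) {n. \<exists>v. evals (r y) [n] v}"
    by metis
  define m :: "nat \<Rightarrow> nat" where "m k = (\<Sum>y\<leftarrow>ys. of_bool (halting_time (code (r y)) k))" for k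
  have m: "real (m k) = (\<Sum>y\<leftarrow>ys. of_bool (halting_time (code (r y)) k))" for k
    unfolding m_def by (induction ys) auto
  show thesis
  proof (rule that[of m "\<lambda>k. Suc (p1 k)" "length ys"])
    show "computable m"
      unfolding m_def[abs_def]
      by (intro computable_sum_list) (rule decidable_halting_time[unfolded decidable_def])
    show "computable (\<lambda>k. Suc (p1 k))" by (intro computable_intros)
    have "(\<lambda>k. (\<Sum>y\<leftarrow>ys. of_bool (halting_time (code (r y)) k)) * (1 / 2 :: real) ^ Suc (p1 k))
        sums sum_list ys"
      using r
    proof (induction ys)
      case (Cons y ys)
      show ?case
        using sums_add[OF halting_time_sums[OF Cons.prems[of y]] Cons.IH] Cons.prems
        by (simp add: distrib_right add_divide_distrib)
    qed simp
    then show "(\<lambda>k. real (m k) * (1 / 2) ^ Suc (p1 k)) sums x" by (simp only: m ys(2))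
    show "(\<Sum>k<t. real (m k) * (1 / 2) ^ (Suc (p1 k) - Suc n)) \<le> real (length ys) * (real n + 2)" for n t
      unfolding m
    proof (induction ys)
      case (Cons y ys)
      then show ?case
        using halting_time_weights[of "code (r y)" n t]
        by (simp add: distrib_right sum.distrib)
    qed simp
  qed
qed

section \<open>Lower bounds for all names, and the growth of \<open>enum\<close>\<close>

locale convergent_rate = rate +
  fixes \<rho> :: real
  assumes tendsto: "(\<lambda>n. real (p n) / real (Suc (q n))) \<longlonglongrightarrow> \<rho>" and \<rho>: "1 \<le> \<rho>" "\<rho> \<le> 2"
begin

text \<open>The factor n^2 eventually exceeds \<open>D * (real n + 3)\<close>. If
  \<open>\<sigma> < \<rho>\<close>, the power of \<open>\<sigma>\<close> is eventually below that of
  the rates; if \<open>\<sigma> = 1\<close>, the summand 1 in the bound suffices. The second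
  condition follows from \<open>\<sigma> < 2\<close>.\<close>

lemma eventually_admissible:
  assumes \<sigma>: "1 \<le> \<sigma>" "\<sigma> < 2" "\<sigma> < \<rho> \<or> \<sigma> = 1" and D: "D \<ge> 0"
  shows "\<forall>\<^sub>F n in sequentially. \<forall>b. real b \<le> D * (real n + 3) * \<sigma> ^ n \<longrightarrow> admissible n b"
proof -
  have "(\<lambda>n. (D * (real n + 3) * \<sigma> ^ n + 1) * real (Suc n) ^ 3 / 2 ^ n) \<longlonglongrightarrow> 0"
  proof -
    define x where "x = \<sigma> / 2"
    have "0 < x" "x < 1" using \<sigma> by (auto simp: x_def)
    then have "(\<lambda>n. D * ((real n + 3) * real (Suc n) ^ 3 * x ^ n) + real (Suc n) ^ 3 * (1 / 2) ^ n)
        \<longlonglongrightarrow> D * 0 + 0"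
      by (intro tendsto_intros) real_asymp+
    moreover have "D * (A * S * x ^ n) + S * (1 / 2) ^ n = (D * A * \<sigma> ^ n + 1) * S / 2 ^ n" for n A S
      by (simp add: x_def power_divide field_simps)
    ultimately show ?thesis by (simp only: mult_zero_right add_0_right)
  qed
  then have "\<forall>\<^sub>F n in sequentially. (D * (real n + 3) * \<sigma> ^ n + 1) * real (Suc n) ^ 3 / 2 ^ n < 1"
    by (rule order_tendstoD) simp
  moreover have "\<forall>\<^sub>F n in sequentially. D * (real n + 3) < real n ^ 2"
    by real_asymp
  moreover have "\<forall>\<^sub>F n in sequentially. \<sigma> ^ n \<le> 1 + (real (p n) / real (Suc (q n))) ^ n"
    using \<sigma>(3)
  proof
    assume "\<sigma> < \<rho>"
    then have "\<forall>\<^sub>F n in sequentially. \<sigma> < real (p n) / real (Suc (q n))"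
      using order_tendstoD(1)[OF tendsto] by blast
    then show ?thesis
    proof eventually_elim
      case (elim n)
      have "\<sigma> ^ n \<le> (real (p n) / real (Suc (q n))) ^ n"
        using elim \<sigma> by (intro power_mono) auto
      then show ?case by simp
    qed
  qed simp
  ultimately show ?thesis
  proof eventually_elim
    case (elim n)
    show ?case
    proof (intro allI impI)
      fix b assume b: "real b \<le> D * (real n + 3) * \<sigma> ^ n"
      let ?d = "Suc (q n)"
      have "real b < real n ^ 2 * \<sigma> ^ n"
        using b elim(2) \<sigma> by (smt (verit) mult_strict_right_mono zero_less_power)
      also have "\<dots> \<le> real n ^ 2 * (1 + (real (p n) / real ?d) ^ n)"
        using elim(3) by (intro mult_left_mono) auto
      finally have "real b * real ?d ^ n < real n ^ 2 * (1 + (real (p n) / real ?d) ^ n) * real ?d ^ n"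
        by (intro mult_strict_right_mono) (auto simp del: of_nat_Suc)
      also have "\<dots> = real n ^ 2 * (real ?d ^ n + real (p n) ^ n)"
        by (simp add: power_divide field_simps del: of_nat_Suc)
      finally have "real (b * ?d ^ n) < real (n\<^sup>2 * (?d ^ n + p n ^ n))"
        by (simp only: of_nat_mult of_nat_add of_nat_power)
      moreover have "real (Suc b * Suc n ^ 3) \<le> real (2 ^ n)"
      proof -
        have "real (Suc b) * real (Suc n) ^ 3 \<le> (D * (real n + 3) * \<sigma> ^ n + 1) * real (Suc n) ^ 3"
          using b by (intro mult_right_mono) auto
        also have "\<dots> \<le> 2 ^ n" using elim(1) by (simp add: divide_less_eq del: of_nat_Suc)
        finally show ?thesis by (simp only: of_nat_mult of_nat_power of_nat_numeral)
      qed
      ultimately show "admissible n b"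
        unfolding admissible_def of_nat_less_iff of_nat_le_iff by blast
    qed
  qed
qed

text \<open>The common core of both lower bounds: at a large level the diagonal argument yields
  inadmissible advice below a bound under which all advice is admissible.\<close>

lemma no_light_name:
  assumes "computable m" "computable g" "(\<lambda>k. real (m k) * (1 / 2) ^ g k) sums value_enum"
    and bound: "\<And>n t. (\<Sum>k<t. real (m k) * (1 / 2) ^ (g k - Suc n)) \<le> D * (real n + 3) * \<sigma> ^ n"
    and \<sigma>: "1 \<le> \<sigma>" "\<sigma> < 2" "\<sigma> < \<rho> \<or> \<sigma> = 1" and D: "D \<ge> 0"
  shows False
proof -
  obtain n0 where n0: "\<And>n. n > n0 \<Longrightarrow> \<exists>b. real b \<le> D * (real n + 3) * \<sigma> ^ n \<and> \<not> admissible n b"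
    using advice_not_admissible[OF assms(1-3)] bound by blast
  obtain n1 where n1: "\<And>n b. n \<ge> n1 \<Longrightarrow> real b \<le> D * (real n + 3) * \<sigma> ^ n \<Longrightarrow> admissible n b"
    using eventually_admissible[OF \<sigma> D] unfolding eventually_sequentially by blast
  show False using n0[of "Suc (n0 + n1)"] n1[of "Suc (n0 + n1)"] by auto
qed

lemma not_regular_value: "\<not> regular value_enum"
proof
  assume "regular value_enum"
  then obtain m g L where *: "computable m" "computable g" "(\<lambda>k. real (m k) * (1 / 2) ^ g k) sums value_enum"
    and le: "\<And>n t. (\<Sum>k<t. real (m k) * (1 / 2) ^ (g k - Suc n)) \<le> real L * (real n + 2)"
    by (rule regular_weighted_name) (rule that)
  \<comment> \<open>A linear bound is the case \<open>\<sigma> = 1\<close>, for every limit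
    \<open>\<rho>\<close>.\<close>
  have "(\<Sum>k<t. real (m k) * (1 / 2) ^ (g k - Suc n)) \<le> real L * (real n + 3) * 1 ^ n" for n t
    using le[of n t] by (simp add: distrib_left)
  then show False by (rule no_light_name[OF *]) auto
qed

lemma growth_ge:
  assumes g: "computable g" "is_name g value_enum"
  shows "ereal \<rho> \<le> growth g"
proof (rule ccontr)
  assume "\<not> ereal \<rho> \<le> growth g"
  then obtain \<sigma>' where \<sigma>': "growth g < ereal \<sigma>'" "\<sigma>' < \<rho>"
    using ereal_dense2[of "growth g" "ereal \<rho>"] by (auto simp: not_le)
  \<comment> \<open>Raising the rate to at least 1 keeps it below 2 and also covers
    \<open>\<rho> = 1\<close>, where no rate in between is available.\<close>
  define \<sigma> where "\<sigma> = max 1 \<sigma>'"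
  have \<sigma>: "1 \<le> \<sigma>" "\<sigma> < 2" "\<sigma> < \<rho> \<or> \<sigma> = 1" using \<sigma>'(2) \<rho> by (auto simp: \<sigma>_def)
  have "growth g < ereal \<sigma>" using \<sigma>'(1) by (rule less_le_trans) (simp add: \<sigma>_def)
  then obtain C where C: "C \<ge> 0" "\<And>n. real (preimage_count g n) \<le> C * \<sigma> ^ n"
    by (rule growth_bound[OF _ \<sigma>(1)]) (rule that)
  obtain D where D: "D \<ge> 0"
    "\<And>n I. (\<Sum>i<I. C * \<sigma> ^ i * (1 / 2) ^ (i - Suc n)) \<le> D * (real n + 3) * \<sigma> ^ n"
    by (rule level_weights_bound[OF \<sigma>(1,2) C(1)]) (rule that)
  have "(\<Sum>k<t. (1 / 2) ^ (g k - Suc n)) \<le> D * (real n + 3) * \<sigma> ^ n" for n t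
  proof (rule sum_le_by_level[of g "\<lambda>i. (1 / 2) ^ (i - Suc n)"])
    fix I
    have "(\<Sum>i<I. real (preimage_count g i) * (1 / 2) ^ (i - Suc n)) \<le>
        (\<Sum>i<I. C * \<sigma> ^ i * (1 / 2) ^ (i - Suc n))"
      by (intro sum_mono mult_right_mono C) auto
    then show "(\<Sum>i<I. real (preimage_count g i) * (1 / 2) ^ (i - Suc n)) \<le> D * (real n + 3) * \<sigma> ^ n"
      using D(2)[where n = n and I = I] by simp
  qed (use finite_name_fiber[OF g(2)] in auto)
  then show False
    using g(2) unfolding is_name_def
    by (intro no_light_name[OF computable_const[of 1] g(1) _ _ \<sigma> D(1)]) auto
qed

text \<open>At most \<open>n\<close> programs times about n^2 (1 + rate^n) pieces of advice give a
  count of order n^3 \<open>R n ^ n\<close>, and the \<open>n\<close>-th roots of the polynomial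
  factor tend to 1.\<close>

lemma growth_enum_le: "growth enum \<le> ereal \<rho>"
proof -
  \<comment> \<open>Single rates may lie below 1. The cut-off at 1 does not change the limit, as
    \<open>\<rho>\<close> is at least 1, and lets \<open>R n ^ n\<close> dominate the
    constants.\<close>
  define R where "R n = max 1 (real (p n) / real (Suc (q n)))" for n
  have R: "R n \<ge> 1" for n by (simp add: R_def)
  have "R \<longlonglongrightarrow> max 1 \<rho>" unfolding R_def[abs_def] by (intro tendsto_max tendsto tendsto_const)
  then have "R \<longlonglongrightarrow> \<rho>" using \<rho>(1) by (simp add: max_def)
  then have "(\<lambda>n. root n 5 * root n (real n) ^ 3 * R n) \<longlonglongrightarrow> 1 * 1 ^ 3 * \<rho>"
    by (intro tendsto_mult tendsto_power LIMSEQ_root LIMSEQ_root_const) auto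
  then have lim: "(\<lambda>n. ereal (root n 5 * root n (real n) ^ 3 * R n)) \<longlonglongrightarrow> ereal \<rho>" by simp
  have "root n (real (preimage_count enum n)) \<le> root n 5 * root n (real n) ^ 3 * R n" if n: "n > 0" for n
  proof -
    let ?c = "card {b. admissible n b}"
    have pow: "(real (p n) / real (Suc (q n))) ^ n \<le> R n ^ n" by (intro power_mono) (auto simp: R_def)
    have Rn: "1 \<le> R n ^ n" using R by simp
    have n1: "1 \<le> real n" using n by simp
    have "real (preimage_count enum n) \<le> 1 + real n * real ?c"
      using enum_fiber(2)[of n] by (metis of_nat_1 of_nat_add of_nat_le_iff of_nat_mult plus_1_eq_Suc)
    also have "\<dots> \<le> 1 + real n * (real n ^ 2 * (1 + (real (p n) / real (Suc (q n))) ^ n) + 1)"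
      by (intro add_left_mono mult_left_mono card_admissible_rate) auto
    also have "\<dots> \<le> 1 + real n * (real n ^ 2 * (R n ^ n + R n ^ n) + 1)"
      using pow Rn by (intro add_left_mono add_right_mono mult_left_mono add_mono) auto
    also have "\<dots> = 2 * (real n ^ 3 * R n ^ n) + real n + 1"
      by (simp add: power2_eq_square power3_eq_cube algebra_simps)
    finally have le: "real (preimage_count enum n) \<le> 2 * (real n ^ 3 * R n ^ n) + real n + 1" .
    have "real n ^ 1 * 1 \<le> real n ^ 3 * R n ^ n" using n1 Rn by (intro mult_mono power_increasing) auto
    with le n1 have "real (preimage_count enum n) \<le> 5 * real n ^ 3 * R n ^ n" by simp
    then have "root n (real (preimage_count enum n)) \<le> root n (5 * real n ^ 3 * R n ^ n)"
      using n by simp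
    also have "\<dots> = root n 5 * root n (real n) ^ 3 * R n"
      using n R[of n] by (simp add: real_root_mult real_root_power real_root_power_cancel)
    finally show ?thesis .
  qed
  then have "growth enum \<le> limsup (\<lambda>n. ereal (root n 5 * root n (real n) ^ 3 * R n))"
    unfolding growth_def
    by (intro Limsup_mono eventually_mono[OF eventually_gt_at_top[of 0]]) auto
  also have "\<dots> = ereal \<rho>" using lim by (rule lim_imp_Limsup[rotated]) simp
  finally show ?thesis .
qed

end

theorem theorem30:
  fixes \<rho> :: real
  assumes "comp_approximable \<rho>"
    and "1 \<le> \<rho>" and "\<rho> \<le> 2"
  shows "\<exists>x. reordered_computable x \<and>
    char_dyadic_value x = ereal \<rho> \<and>
    (\<exists>f. computable f \<and> is_name f x \<and> growth f = char_dyadic_value x) \<and>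
    \<not> regular x"
proof -
  obtain r s a b where r: "\<And>n. r n = (- 1) ^ s n * of_nat (a n) / of_nat (Suc (b n))"
    and ab: "computable a" "computable b" and lim: "(\<lambda>n. real_of_rat (r n)) \<longlonglongrightarrow> \<rho>"
    using assms(1) unfolding comp_approximable_def computable_rat_seq_def by blast
  \<comment> \<open>Passing to absolute values removes the signs and preserves the limit, which is
    positive.\<close>
  have "\<bar>real_of_rat (r n)\<bar> = real (a n) / real (Suc (b n))" for n
    unfolding r by (simp add: of_rat_mult of_rat_divide of_rat_power of_rat_minus abs_mult power_abs
        del: of_nat_Suc)
  then have "(\<lambda>n. real (a n) / real (Suc (b n))) \<longlonglongrightarrow> \<rho>"
    using tendsto_rabs[OF lim] assms(2) by simp
  then interpret convergent_rate a b \<rho>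
    using ab assms by unfold_locales
  have growth: "growth enum = ereal \<rho>"
    using growth_enum_le growth_ge[OF computable_enum is_name_enum] by (rule antisym)
  have "char_dyadic_value value_enum = ereal \<rho>"
    unfolding char_dyadic_value_def
  proof (rule antisym)
    show "Inf {growth f |f. computable f \<and> is_name f value_enum} \<le> ereal \<rho>"
      using growth computable_enum is_name_enum by (intro Inf_lower) force
    show "ereal \<rho> \<le> Inf {growth f |f. computable f \<and> is_name f value_enum}"
      using growth_ge by (intro Inf_greatest) blast
  qed
  then show ?thesis
    using growth computable_enum is_name_enum reordered_computable_value not_regular_value
    by (intro exI[of _ value_enum]) auto
qed

end
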